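(* Fix some $\epsilon$, $0<\epsilon<1$. In the mobile telephone model with tag length $b=1$ and any stability factor $\tau\ge1$, and with shared randomness available to all nodes, the SharedBit gossip algorithm solves the $\epsilon$-gossip problem in $$O\left(\frac{n\sqrt{\Delta\log\Delta}}{(1-\epsilon)\alpha}\right)$$ rounds, where $n$ is the network size and $\alpha$ and $\Delta$ are the vertex expansion and maximum degree of the dynamic graph.
   Context: Mobile telephone model. Time proceeds in synchronous rounds $1,2,\dots$, and all nodes start in round 1. The topology is a dynamic graph $G_1,G_2,\dots$ fixed before the execution begins, where each $G_r=(V,E_r)$ is a connected undirected graph on the same node set $V$, $|V|=n>1$. Stability factor $\tau\ge1$: at least $\tau$ rounds pass between any two changes of the topology ($\tau=1$: it may change arbitrarily every round; $\tau=\infty$: it never changes). At the beginning of round $r$ each node selects a tag of $b$ bits to advertise, then learns its neighbor set in $G_r$ and the tags of its neighbors. Each node may then send a connection proposal to at most one neighbor. A node that sends a proposal cannot receive one; a node that does not send a proposal and receives at least one proposal accepts one chosen uniformly at random among those received. A proposer and acceptor are then connected for the round and may exchange at most $O(1)$ tokens and $O(\mathrm{polylog}(N))$ additional bits. Graph parameters. For a graph $G=(V,E)$ and $S\subseteq V$ nonempty, $\partial S$ is the set of nodes in $V\setminus S$ with a neighbor in $S$, and $\alpha(G)=\min_{S\subset V,\,0<|S|\le n/2}|\partial S|/|S|$. For a dynamic graph, $\alpha=\min_i\alpha(G_i)$ and $\Delta$ is the largest maximum degree of any $G_i$. $\epsilon$-gossip problem. Each node knows an upper bound $N\ge n$ and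 has a unique ID in $[N]=\{1,\dots,N\}$. Every one of the $n$ nodes starts with its own token, labelled by its ID; tokens are black boxes that can only be passed through connections. $T_u(r)$ is the set of tokens known by $u$ at the beginning of round $r$. $\epsilon$-gossip is solved once there is a set $S\subseteq V$ with $|S|\ge\epsilon n$ such that for all $u,v\in S$, $u$ knows $v$'s token and $v$ knows $u$'s token. An algorithm solves $\epsilon$-gossip in $f$ rounds if this holds by round $f$ with probability at least $1-1/n$. $O(\cdot)$ is asymptotic (as $n\to\infty$) with universal constants. Transfer$(\varepsilon)$ subroutine. Run by two connected nodes $u,v$ with token sets $T_u,T_v$ (using fresh private randomness); if $T_u\ne T_v$, then with probability at least $1-\varepsilon$ the smallest token in $(T_u\cup T_v)\setminus(T_u\cap T_v)$ is transferred by the node that knows it to the node that does not. In all cases nodes only gain tokens that the other node knows. SharedBit. All nodes have access to a common uniformly random bit string $\hat r$ of length $cN^3(\lceil\log N\rceil+1)$, partitioned into $cN^2$ groups labelled $1,\dots,cN^2$, each consisting of $N$ bundles labelled $1,\dots,N$ of $\lceil\log N\rceil+1$ bits each. In round $r\le cN^2$, for each token $t\in T_u(r)$ let $t.\mathrm{bit}$ be the first bit of bundle $t$ of group $r$. Node $u$ advertises $b_u(r)=\left(\sum_{t\in T_u(r)}t.\mathrm{bit}\right)\bmod 2$. If $b_u(r)=0$, $u$ sends no proposal and waits to receive proposals. If $b_u(r)=1$ and $u$ has at least one neighbor advertising $0$, then $u$ chooses one of these neighbors uniformly at random (the choice being made with the remaining $\lceil\log N\rceil$ bits of the bundle of group $r$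 labelled by $u$'s ID, and treated as uniform) and sends it a proposal. Two nodes that connect run Transfer$(n^{-c_t})$. Here $c,c_t\ge1$ are sufficiently large constants. After round $cN^2$ the behavior is arbitrary. *)

theory Defs
  imports "HOL-Probability.Probability" "HOL-Library.Extended_Nat"
begin

text \<open>
  Nodes are identified with their unique IDs, so the node set is some
  \<open>V \<subseteq> {1..N}\<close>.  The token initially held by a node is labelled by its ID.
\<close>

type_synonym node = nat
type_synonym token = nat
type_synonym graph = "(node \<times> node) set"
type_synonym state = "node \<Rightarrow> token set"


section \<open>Dynamic graphs\<close>

definition connected_graph :: "node set \<Rightarrow> graph \<Rightarrow> bool" where
  "connected_graph V E \<longleftrightarrow>
     E \<subseteq> V \<times> V \<and> sym E \<and> irrefl E \<and> (\<forall>u\<in>V. \<forall>v\<in>V. (u, v) \<in> E\<^sup>*)"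

text \<open>
  A dynamic graph is a sequence \<open>G 1, G 2, \<dots>\<close>; the value \<open>G 0\<close> is never used.
\<close>

definition dynamic_graph :: "node set \<Rightarrow> (nat \<Rightarrow> graph) \<Rightarrow> bool" where
  "dynamic_graph V G \<longleftrightarrow> finite V \<and> (\<forall>r\<ge>1. connected_graph V (G r))"

definition has_stability :: "enat \<Rightarrow> (nat \<Rightarrow> graph) \<Rightarrow> bool" where
  "has_stability \<tau> G \<longleftrightarrow>
     (\<forall>r s. 1 \<le> r \<and> r < s \<and> G r \<noteq> G (r + 1) \<and> G s \<noteq> G (s + 1) \<longrightarrow> \<tau> \<le> enat (s - r)) \<and>
     (\<tau> = \<infinity> \<longrightarrow> (\<forall>r\<ge>1. G r = G 1))"

definition boundary :: "node set \<Rightarrow> graph \<Rightarrow> node set \<Rightarrow> node set" where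
  "boundary V E S = {v \<in> V - S. \<exists>u\<in>S. (u, v) \<in> E}"

definition vertex_expansion :: "node set \<Rightarrow> graph \<Rightarrow> real" where
  "vertex_expansion V E =
     Min ((\<lambda>S. real (card (boundary V E S)) / real (card S)) `
            {S. S \<subseteq> V \<and> 0 < card S \<and> real (card S) \<le> real (card V) / 2})"

definition max_degree :: "node set \<Rightarrow> graph \<Rightarrow> nat" where
  "max_degree V E = Max ((\<lambda>u. card (E `` {u})) ` V)"

text \<open>
  Only finitely many graphs exist on a finite node set, so the infimum and
  supremum below are attained for every dynamic graph.
\<close>

definition dyn_expansion :: "node set \<Rightarrow> (nat \<Rightarrow> graph) \<Rightarrow> real" where
  "dyn_expansion V G = (INF r\<in>{1..}. vertex_expansion V (G r))"

definition dyn_max_degree :: "node set \<Rightarrow> (nat \<Rightarrow> graph) \<Rightarrow> nat" where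
  "dyn_max_degree V G = (SUP r\<in>{1..}. max_degree V (G r))"


section \<open>One round of the mobile telephone model\<close>

definition acceptors :: "node set \<Rightarrow> (node \<Rightarrow> node option) \<Rightarrow> node set" where
  "acceptors V p = {v \<in> V. p v = None \<and> (\<exists>u\<in>V. p u = Some v)}"

definition acceptances ::
    "node set \<Rightarrow> (node \<Rightarrow> node option) \<Rightarrow> (node \<Rightarrow> node option) pmf" where
  "acceptances V p =
     Pi_pmf (acceptors V p) None (\<lambda>v. map_pmf Some (pmf_of_set {u \<in> V. p u = Some v}))"

text \<open>
  A pairwise subroutine \<open>X u v A B\<close> is run by a proposer \<open>u\<close> with token set \<open>A\<close> and the
  acceptor \<open>v\<close> with token set \<open>B\<close>; it yields the new token sets of \<open>u\<close> and \<open>v\<close>.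
\<close>

type_synonym subroutine =
  "node \<Rightarrow> node \<Rightarrow> token set \<Rightarrow> token set \<Rightarrow> (token set \<times> token set) pmf"

definition exchanges ::
    "subroutine \<Rightarrow> node set \<Rightarrow> (node \<Rightarrow> node option) \<Rightarrow> (node \<Rightarrow> node option) \<Rightarrow> state
       \<Rightarrow> (node \<Rightarrow> token set \<times> token set) pmf" where
  "exchanges X V p a T =
     Pi_pmf (acceptors V p) ({}, {}) (\<lambda>v. X (the (a v)) v (T (the (a v))) (T v))"

text \<open>
  In \<open>update p a x T\<close>, \<open>p\<close> maps proposers to the proposed node, \<open>a\<close> maps acceptors to
  the accepted proposer, and \<open>x\<close> maps acceptors to the outcome of their exchange.
\<close>

definition update ::
    "(node \<Rightarrow> node option) \<Rightarrow> (node \<Rightarrow> node option) \<Rightarrow> (node \<Rightarrow> token set \<times> token set)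
       \<Rightarrow> state \<Rightarrow> state" where
  "update p a x T = (\<lambda>w.
     if a w \<noteq> None then snd (x w)
     else (case p w of
             None \<Rightarrow> T w
           | Some v \<Rightarrow> if a v = Some w then fst (x v) else T w))"

definition mtm_round ::
    "node set \<Rightarrow> subroutine \<Rightarrow> (node \<Rightarrow> node option) pmf \<Rightarrow> state \<Rightarrow> state pmf" where
  "mtm_round V X proposals T =
     do {
       p \<leftarrow> proposals;
       a \<leftarrow> acceptances V p;
       x \<leftarrow> exchanges X V p a T;
       return_pmf (update p a x T)
     }"


section \<open>The gossip problem\<close>

definition gossip_solved :: "real \<Rightarrow> node set \<Rightarrow> state \<Rightarrow> bool" where
  "gossip_solved \<epsilon> V T \<longleftrightarrow>
     (\<exists>S\<subseteq>V. real (card S) \<ge> \<epsilon> * real (card V) \<and>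
        (\<forall>u\<in>S. \<forall>v\<in>S. v \<in> T u \<and> u \<in> T v))"

text \<open>
  \<open>run f\<close> is the distribution of the sequence of states at the beginning of rounds
  \<open>1, \<dots>, f + 1\<close>, so that \<open>h ! (r - 1)\<close> is the state at the beginning of round \<open>r\<close>.
\<close>

definition solves_gossip :: "real \<Rightarrow> node set \<Rightarrow> (nat \<Rightarrow> state list pmf) \<Rightarrow> nat \<Rightarrow> bool" where
  "solves_gossip \<epsilon> V run f \<longleftrightarrow>
     measure_pmf.prob (run f) {h. \<exists>r\<in>{1..f}. gossip_solved \<epsilon> V (h ! (r - 1))}
       \<ge> 1 - 1 / real (card V)"


section \<open>The Transfer subroutine\<close>

text \<open>
  \<open>q\<close> is the constant bounding the number of tokens that may pass through a connection
  and \<open>\<delta>\<close> is the failure probability.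
\<close>

definition is_transfer :: "nat \<Rightarrow> node set \<Rightarrow> real \<Rightarrow> subroutine \<Rightarrow> bool" where
  "is_transfer q V \<delta> X \<longleftrightarrow>
     (\<forall>u\<in>V. \<forall>v\<in>V. \<forall>A B. u \<noteq> v \<and> A \<subseteq> V \<and> B \<subseteq> V \<longrightarrow>
        (\<forall>(A', B')\<in>set_pmf (X u v A B).
            A \<subseteq> A' \<and> A' \<subseteq> A \<union> B \<and> B \<subseteq> B' \<and> B' \<subseteq> A \<union> B \<and>
            card (A' - A) + card (B' - B) \<le> q) \<and>
        (A \<noteq> B \<longrightarrow>
           measure_pmf.prob (X u v A B) {(A', B'). Min ((A \<union> B) - (A \<inter> B)) \<in> A' \<inter> B'}
             \<ge> 1 - \<delta>))"


section \<open>The SharedBit algorithm\<close>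

text \<open>
  The shared string is indexed by (group, bundle, position within the bundle), which
  gives \<open>c * N\<^sup>2 * N * (\<lceil>log 2 N\<rceil> + 1)\<close> independent uniform bits; position 0 is the first
  bit of a bundle.
\<close>

type_synonym bit_string = "nat \<times> nat \<times> nat \<Rightarrow> bool"

definition shared_string :: "nat \<Rightarrow> nat \<Rightarrow> bit_string pmf" where
  "shared_string c N =
     Pi_pmf ({1..c * N^2} \<times> {1..N} \<times> {..<nat \<lceil>log 2 (real N)\<rceil> + 1}) False
       (\<lambda>_. pmf_of_set (UNIV :: bool set))"

definition tag :: "bit_string \<Rightarrow> nat \<Rightarrow> state \<Rightarrow> node \<Rightarrow> nat" where
  "tag \<rho> r T u = (\<Sum>t\<in>T u. of_bool (\<rho> (r, t, 0))) mod 2"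

definition zero_neighbors ::
    "graph \<Rightarrow> bit_string \<Rightarrow> nat \<Rightarrow> state \<Rightarrow> node \<Rightarrow> node set" where
  "zero_neighbors E \<rho> r T u = {v \<in> E `` {u}. tag \<rho> r T v = 0}"

definition senders ::
    "node set \<Rightarrow> graph \<Rightarrow> bit_string \<Rightarrow> nat \<Rightarrow> state \<Rightarrow> node set" where
  "senders V E \<rho> r T = {u \<in> V. tag \<rho> r T u = 1 \<and> zero_neighbors E \<rho> r T u \<noteq> {}}"

text \<open>
  The choice that a sender \<open>u\<close> makes with the trailing bits of bundle \<open>u\<close> of group \<open>r\<close> is
  treated as exactly uniform.  These bits have no other use and every group is used in
  one round only, so the choices are independent of each other and of all tags.
\<close>

definition sharedbit_proposals ::
    "node set \<Rightarrow> graph \<Rightarrow> bit_string \<Rightarrow> nat \<Rightarrow> state \<Rightarrow> (node \<Rightarrow> node option) pmf" where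
  "sharedbit_proposals V E \<rho> r T =
     Pi_pmf (senders V E \<rho> r T) None
       (\<lambda>u. map_pmf Some (pmf_of_set (zero_neighbors E \<rho> r T u)))"

text \<open>
  After round \<open>c * N\<^sup>2\<close> the next state is given by the parameter \<open>beyond\<close>, which may depend
  on the shared string and on the whole history.
\<close>

fun sharedbit_history ::
    "nat \<Rightarrow> nat \<Rightarrow> node set \<Rightarrow> (nat \<Rightarrow> graph) \<Rightarrow> subroutine
       \<Rightarrow> (bit_string \<Rightarrow> state list \<Rightarrow> state pmf) \<Rightarrow> bit_string \<Rightarrow> nat \<Rightarrow> state list pmf" where
  "sharedbit_history c N V G X beyond \<rho> 0 = return_pmf [\<lambda>u. {u}]"
| "sharedbit_history c N V G X beyond \<rho> (Suc m) =
     do {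
       h \<leftarrow> sharedbit_history c N V G X beyond \<rho> m;
       T \<leftarrow> (if Suc m \<le> c * N^2
             then mtm_round V X (sharedbit_proposals V (G (Suc m)) \<rho> (Suc m) (last h)) (last h)
             else beyond \<rho> h);
       return_pmf (h @ [T])
     }"

definition sharedbit ::
    "nat \<Rightarrow> nat \<Rightarrow> node set \<Rightarrow> (nat \<Rightarrow> graph) \<Rightarrow> subroutine
       \<Rightarrow> (bit_string \<Rightarrow> state list \<Rightarrow> state pmf) \<Rightarrow> nat \<Rightarrow> state list pmf" where
  "sharedbit c N V G X beyond m =
     bind_pmf (shared_string c N) (\<lambda>\<rho>. sharedbit_history c N V G X beyond \<rho> m)"

end

theory Submission
  imports Defs
begin

text \<open>
  While gossip is unsolved, every class of nodes with equal token sets has fewer than \<open>\<epsilon> n\<close>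
  members, so some union \<open>S\<close> of classes has between \<open>(1 - \<epsilon>) n / 2\<close> and \<open>n / 2\<close> nodes.  Vertex
  expansion yields a matching of \<open>k \<ge> \<alpha> (1 - \<epsilon>) n / 8\<close> edges across the cut of \<open>S\<close>, each joining
  nodes with different token sets.  The fresh shared bits give the endpoints of such an edge
  different tags with probability one half, and the uniform proposals then lead to
  \<open>\<Omega>(k / sqrt \<Delta>)\<close> connections in expectation, and to \<open>1 / 2\<close> at the very least.

  Each connection transfers a token with probability at least one half, so
  \<open>exp (- (number of known tokens) / n)\<close> shrinks in expectation by the factor
  \<open>exp (- \<Omega>(\<alpha> (1 - \<epsilon>) / sqrt \<Delta>))\<close>, and at least by \<open>exp (- 1 / (8 n))\<close>, in every unsolved round.  It
  never drops below \<open>exp (- n)\<close>, hence \<open>O(n sqrt \<Delta> / ((1 - \<epsilon>) \<alpha>))\<close> rounds suffice.  If this bound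
  exceeds \<open>c N\<^sup>2\<close>, the second factor already gives success within the \<open>c N\<^sup>2\<close> rounds for which
  shared bits are available.
\<close>

section \<open>Finite distributions\<close>

lemma expectation_mono_finite:
  fixes f g :: "'a \<Rightarrow> real"
  assumes "finite (set_pmf p)" "\<And>x. x \<in> set_pmf p \<Longrightarrow> f x \<le> g x"
  shows "measure_pmf.expectation p f \<le> measure_pmf.expectation p g"
  using assms
  by (intro integral_mono_AE integrable_measure_pmf_finite) (auto simp: AE_measure_pmf_iff)

lemma expectation_nonneg_pmf: "(\<And>x. 0 \<le> f x) \<Longrightarrow> 0 \<le> measure_pmf.expectation p (f :: _ \<Rightarrow> real)"
  by (intro integral_nonneg_AE) simp

lemma expectation_cong:
  fixes f g :: "'a \<Rightarrow> real"
  assumes "p = p'" "\<And>x. x \<in> set_pmf p' \<Longrightarrow> f x = g x"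
  shows "measure_pmf.expectation p f = measure_pmf.expectation p' g"
  using assms by (auto intro!: integral_cong_AE simp: AE_measure_pmf_iff)

lemma expectation_bind_finite:
  fixes h :: "'b \<Rightarrow> real"
  assumes "finite (set_pmf p)" "\<And>x. x \<in> set_pmf p \<Longrightarrow> finite (set_pmf (f x))"
  shows "measure_pmf.expectation (bind_pmf p f) h =
    measure_pmf.expectation p (\<lambda>x. measure_pmf.expectation (f x) h)"
  using assms by (subst pmf_expectation_bind[of "set_pmf p"]) (auto simp: integral_measure_pmf[of "set_pmf p"])

text \<open>The size of a random set is the sum of its membership indicators, so linearity of
  expectation applies without any independence.\<close>

lemma expectation_card:
  fixes A :: "'a \<Rightarrow> 'b set"
  assumes "finite (set_pmf p)" "finite V" "\<And>x. A x \<subseteq> V"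
  shows "measure_pmf.expectation p (\<lambda>x. real (card (A x))) =
    (\<Sum>v\<in>V. measure_pmf.prob p {x. v \<in> A x})"
proof -
  have "real (card (A x)) = (\<Sum>v\<in>V. indicator {x. v \<in> A x} x)" for x
    using assms sum.inter_restrict[of V "\<lambda>_. 1::real" "A x"]
    by (simp add: indicator_def Int_absorb1 of_bool_def flip: sum.inter_filter)
  then have "measure_pmf.expectation p (\<lambda>x. real (card (A x))) =
    (\<Sum>v\<in>V. measure_pmf.expectation p (indicator {x. v \<in> A x}))"
    using assms by (simp add: Bochner_Integration.integral_sum integrable_measure_pmf_finite)
  then show ?thesis by simp
qed

lemma finite_set_Pi_pmf:
  assumes "finite A" "\<And>x. x \<in> A \<Longrightarrow> finite (set_pmf (p x))"
  shows "finite (set_pmf (Pi_pmf A d p))"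
  using assms by (subst set_Pi_pmf) auto

lemma prob_Pi_pmf_component:
  assumes "finite A" "i \<in> A"
  shows "measure_pmf.prob (Pi_pmf A d p) {x. P (x i)} = measure_pmf.prob (p i) {y. P y}"
proof -
  have "measure_pmf.prob (p i) {y. P y} = measure_pmf.prob (map_pmf (\<lambda>x. x i) (Pi_pmf A d p)) {y. P y}"
    using assms by (simp add: Pi_pmf_component)
  then show ?thesis by (simp add: measure_map_pmf vimage_def)
qed

lemma exp_minus_le:
  fixes x :: real
  assumes "0 \<le> x"
  shows "exp (- x) \<le> 1 / (1 + x)"
  using exp_ge_add_one_self[of x] assms by (simp add: exp_minus divide_simps)

text \<open>For \<open>y\<close> in the unit interval \<open>(1 - y / 2) * (1 + y)\<close> is at
  least one. A bound linear in \<open>y\<close> is what lets an expected number of successes enter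
  the weight estimate.\<close>

lemma exp_minus_le_half:
  fixes y :: real
  assumes "0 \<le> y" "y \<le> 1"
  shows "exp (- y) \<le> 1 - y / 2"
proof -
  have "y * y \<le> y * 1" using assms by (intro mult_left_mono)
  then have "1 \<le> (1 - y / 2) * (1 + y)" by (simp add: algebra_simps)
  then have "1 / (1 + y) \<le> 1 - y / 2" using assms by (simp add: divide_le_eq)
  then show ?thesis using exp_minus_le[OF assms(1)] by linarith
qed

section \<open>Expansion and matchings\<close>

lemma vertex_expansion_le:
  assumes "finite V" "S \<subseteq> V" "S \<noteq> {}" "real (card S) \<le> real (card V) / 2"
  shows "vertex_expansion V E * real (card S) \<le> real (card (boundary V E S))"
proof -
  have "card S > 0" using assms by (meson card_gt_0_iff finite_subset)
  moreover have "vertex_expansion V E \<le> real (card (boundary V E S)) / real (card S)"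
    unfolding vertex_expansion_def using assms \<open>card S > 0\<close>
    by (intro Min_le finite_imageI) (auto intro!: imageI finite_subset[of _ "Pow V"])
  ultimately show ?thesis by (simp add: field_simps)
qed

text \<open>A set with empty boundary is closed under edges, so a path starting in it can never
  leave it.\<close>

lemma boundary_nonempty:
  assumes "connected_graph V E" "S \<subseteq> V" "S \<noteq> {}" "S \<noteq> V"
  shows "boundary V E S \<noteq> {}"
proof
  assume empty: "boundary V E S = {}"
  obtain s t where st: "s \<in> S" "t \<in> V" "t \<notin> S" using assms by blast
  then have "(s, t) \<in> E\<^sup>*" using assms unfolding connected_graph_def by blast
  then have "t \<in> S"
  proof induction
    case (step y z)
    then show ?case using empty assms(1) unfolding boundary_def connected_graph_def by blast
  qed (use st in simp)
  then show False using st by simp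
qed

text \<open>By connectivity every boundary has at least one node, while \<open>card S\<close> is at
  most \<open>card V\<close>. The bound is the same in every round, which keeps the infimum
  \<open>dyn_expansion\<close> positive.\<close>

lemma vertex_expansion_ge:
  assumes "finite V" "card V > 1" "connected_graph V E"
  shows "1 / real (card V) \<le> vertex_expansion V E"
  unfolding vertex_expansion_def
proof (rule Min.boundedI)
  let ?F = "{S. S \<subseteq> V \<and> 0 < card S \<and> real (card S) \<le> real (card V) / 2}"
  show "finite ((\<lambda>S. real (card (boundary V E S)) / real (card S)) ` ?F)"
    using assms by (intro finite_imageI) (auto intro!: finite_subset[of _ "Pow V"])
  obtain v where "v \<in> V" using assms by fastforce
  then have "{v} \<in> ?F" using assms by auto
  then show "(\<lambda>S. real (card (boundary V E S)) / real (card S)) ` ?F \<noteq> {}" by blast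
  fix x assume "x \<in> (\<lambda>S. real (card (boundary V E S)) / real (card S)) ` ?F"
  then obtain S where S: "S \<subseteq> V" "0 < card S" "real (card S) \<le> real (card V) / 2"
    and x: "x = real (card (boundary V E S)) / real (card S)" by blast
  have "S \<noteq> V" "S \<noteq> {}" using S assms by auto
  then have "boundary V E S \<noteq> {}" using boundary_nonempty assms S by blast
  moreover have "finite (boundary V E S)" using assms unfolding boundary_def by simp
  ultimately have "1 \<le> card (boundary V E S)" by (simp add: Suc_le_eq card_gt_0_iff)
  moreover have "card S \<le> card V" using S assms by (simp add: card_mono)
  ultimately show "1 / real (card V) \<le> x" unfolding x using S by (intro frac_le) auto
qed

text \<open>Test the minimum on a set of \<open>card V div 2\<close> nodes: its boundary lies in the
  complement, which is at most twice as large.\<close>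

lemma vertex_expansion_le_2:
  assumes "finite V" "card V > 1"
  shows "vertex_expansion V E \<le> 2"
proof -
  obtain S where S: "S \<subseteq> V" "card S = card V div 2"
    using assms by (metis div_le_dividend obtain_subset_with_card_n)
  have pos: "card V div 2 \<ge> 1" using assms by linarith
  then have "S \<noteq> {}" using S by auto
  then have "vertex_expansion V E * real (card S) \<le> real (card (boundary V E S))"
    using S assms by (intro vertex_expansion_le) auto
  also have "card (boundary V E S) \<le> card (V - S)"
    using assms unfolding boundary_def by (intro card_mono) auto
  then have "real (card (boundary V E S)) \<le> real (2 * card S)"
    using S assms pos by (subst of_nat_le_iff) (simp add: card_Diff_subset finite_subset; linarith)
  finally show ?thesis using S pos by (simp add: mult.commute)
qed

section \<open>Expansion and maximum degree of the dynamic graph\<close>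

lemma dyn_expansion_le:
  assumes "dynamic_graph V G" "card V > 1" "r \<ge> 1"
  shows "dyn_expansion V G \<le> vertex_expansion V (G r)"
  unfolding dyn_expansion_def
proof (rule cINF_lower)
  have "0 \<le> vertex_expansion V (G i)" if "i \<ge> 1" for i
    using vertex_expansion_ge[of V "G i"] assms that unfolding dynamic_graph_def
    by (smt (verit) divide_nonneg_nonneg of_nat_0_le_iff)
  then show "bdd_below ((\<lambda>r. vertex_expansion V (G r)) ` {1..})" by (intro bdd_belowI[of _ 0]) auto
qed (use assms in simp)

lemma dyn_expansion_pos:
  assumes "dynamic_graph V G" "card V > 1"
  shows "0 < dyn_expansion V G"
proof -
  have "1 / real (card V) \<le> dyn_expansion V G"
    unfolding dyn_expansion_def using assms
    by (intro cINF_greatest vertex_expansion_ge) (auto simp: dynamic_graph_def)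
  then show ?thesis using assms by (smt (verit) divide_pos_pos of_nat_0_less_iff less_trans zero_less_one)
qed

lemma degree_le_card:
  assumes "finite V" "connected_graph V E"
  shows "card (E `` {u}) \<le> card V"
  using assms by (intro card_mono) (auto simp: connected_graph_def)

lemma degree_le_dyn_max_degree:
  assumes "dynamic_graph V G" "r \<ge> 1" "u \<in> V"
  shows "card (G r `` {u}) \<le> dyn_max_degree V G"
proof -
  have fin: "finite V" using assms dynamic_graph_def by blast
  have "max_degree V (G i) \<le> card V" if "i \<ge> 1" for i
    unfolding max_degree_def using assms fin that degree_le_card
    by (intro Max.boundedI) (auto simp: dynamic_graph_def)
  then have "bdd_above ((\<lambda>i. max_degree V (G i)) ` {1..})" by (intro bdd_aboveI[of _ "card V"]) auto
  then have "max_degree V (G r) \<le> dyn_max_degree V G"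
    unfolding dyn_max_degree_def using assms by (intro cSUP_upper) auto
  moreover have "card (G r `` {u}) \<le> max_degree V (G r)"
    unfolding max_degree_def using assms fin by (intro Max_ge) auto
  ultimately show ?thesis by simp
qed

text \<open>A connected graph on three or more nodes contains two edges that share a node: an edge
  \<open>u v\<close>, and an edge from one of its ends to a third node. This makes
  \<open>log 2 \<Delta>\<close> at least one.\<close>

lemma dyn_max_degree_ge_2:
  assumes "dynamic_graph V G" "card V \<ge> 3"
  shows "2 \<le> dyn_max_degree V G"
proof (rule ccontr)
  assume "\<not> ?thesis"
  then have deg: "card (G 1 `` {u}) \<le> 1" if "u \<in> V" for u
    using degree_le_dyn_max_degree[OF assms(1), of 1 u] that by simp
  have fin: "finite V" and conn: "connected_graph V (G 1)" using assms dynamic_graph_def by auto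
  obtain u where u: "u \<in> V" using assms by fastforce
  have "card {u} \<noteq> card V" using assms by simp
  then have "boundary V (G 1) {u} \<noteq> {}" using boundary_nonempty[OF conn, of "{u}"] u by blast
  then obtain v where v: "v \<in> V" "(u, v) \<in> G 1" unfolding boundary_def by auto
  have "card {u, v} \<noteq> card V" using assms card_insert_le_m1[of 2 "{v}" u] by auto
  then obtain w where w: "w \<in> boundary V (G 1) {u, v}"
    using boundary_nonempty[OF conn, of "{u, v}"] u v by blast
  then obtain x where x: "x \<in> {u, v}" "(x, w) \<in> G 1" "w \<noteq> u" "w \<noteq> v" unfolding boundary_def by auto
  have vu: "(v, u) \<in> G 1" using v conn unfolding connected_graph_def by (meson symE)
  define y where "y = (if x = u then v else u)"
  have "{y, w} \<subseteq> G 1 `` {x}" using x v vu unfolding y_def by auto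
  moreover have "finite (G 1 `` {x})" using fin conn unfolding connected_graph_def
    by (auto intro: finite_subset[of _ V])
  ultimately have "card {y, w} \<le> card (G 1 `` {x})" by (simp add: card_mono)
  moreover have "card {y, w} = 2" using x unfolding y_def by auto
  moreover have "x \<in> V" using x u v by auto
  ultimately show False using deg[of x] by simp
qed

text \<open>
  The endpoints of a maximal matching across the cut cover all crossing edges, so deleting them
  from \<open>S\<close> leaves a set whose boundary consists of endpoints only.
\<close>

lemma cut_matching:
  assumes "finite V" "E \<subseteq> V \<times> V" "S \<subseteq> V" "0 \<le> a" "a \<le> 2"
    and expand: "\<And>S'. S' \<subseteq> S \<Longrightarrow> S' \<noteq> {} \<Longrightarrow> a * real (card S') \<le> real (card (boundary V E S'))"
  shows "\<exists>M. M \<subseteq> E \<inter> (S \<times> (V - S)) \<and> inj_on fst M \<and> inj_on snd M \<and> a * real (card S) \<le> 4 * real (card M)"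
proof -
  let ?P = "\<lambda>M. M \<subseteq> E \<inter> (S \<times> (V - S)) \<and> inj_on fst M \<and> inj_on snd M"
  have finE: "finite E" using assms by (meson finite_SigmaI finite_subset)
  have "?P {}" by simp
  moreover have "\<forall>M. ?P M \<longrightarrow> card M < Suc (card E)"
    using finE by (auto simp: less_Suc_eq_le intro: card_mono)
  ultimately have "\<exists>M. ?P M \<and> (\<forall>M'. ?P M' \<longrightarrow> card M' \<le> card M)"
    by (rule Lattices_Big.ex_has_greatest_nat)
  then obtain M where M: "?P M" and max: "\<And>M'. ?P M' \<Longrightarrow> card M' \<le> card M"
    by metis
  have finM: "finite M" using M finE by (meson finite_subset le_infE)
  have cover: "u \<in> fst ` M \<or> v \<in> snd ` M" if "(u, v) \<in> E" "u \<in> S" "v \<in> V - S" for u v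
  proof (rule ccontr)
    assume no: "\<not> ?thesis"
    then have "?P (insert (u, v) M)" using M that by (auto simp: inj_on_insert)
    moreover have "(u, v) \<notin> M" using no by force
    ultimately show False using max[of "insert (u, v) M"] finM by auto
  qed
  have C: "card (fst ` M) = card M" "card (snd ` M) = card M"
    using M by (auto intro: card_image)
  have finS: "finite S" using assms finite_subset by blast
  have sub: "fst ` M \<subseteq> S" using M by auto
  have cS: "real (card (S - fst ` M)) = real (card S) - real (card M)"
    using sub C finS finM by (simp add: card_Diff_subset card_mono of_nat_diff flip: C(1))
  \<comment> \<open>If the matching covers \<open>S\<close>, then \<open>a \<le> 2\<close> suffices.
    Otherwise the uncovered part has boundary at most \<open>2 * card M\<close>, and the covered
    part costs another \<open>a * card M \<le> 2 * card M\<close>; together this is the factor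
    4.\<close>
  have "a * real (card S) \<le> 4 * real (card M)"
  proof (cases "S - fst ` M = {}")
    case True
    then have "card S = card M" using cS unfolding True by simp
    then show ?thesis using assms by (auto intro: mult_right_mono)
  next
    case False
    have "boundary V E (S - fst ` M) \<subseteq> fst ` M \<union> snd ` M"
      using cover unfolding boundary_def by blast
    then have "card (boundary V E (S - fst ` M)) \<le> card (fst ` M \<union> snd ` M)"
      using finM by (intro card_mono) auto
    also have "\<dots> \<le> 2 * card M" using card_Un_le[of "fst ` M" "snd ` M"] C by simp
    finally have "a * (real (card S) - real (card M)) \<le> 2 * real (card M)"
      using expand[of "S - fst ` M"] False cS by simp
    moreover have "a * real (card M) \<le> 2 * real (card M)" using assms by (intro mult_right_mono) auto
    ultimately show ?thesis by (simp add: algebra_simps)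
  qed
  then show ?thesis using M by blast
qed

text \<open>
  Take \<open>S\<close> as a largest union of classes with at most \<open>n / 2\<close> nodes: one further class must
  exceed \<open>n / 2\<close>, and the complement is then again a union of at most \<open>n / 2\<close> nodes.
\<close>

lemma unsolved_balanced_cut:
  assumes "finite V" "V \<noteq> {}" "\<And>u. u \<in> V \<Longrightarrow> u \<in> T u" "\<not> gossip_solved \<epsilon> V T"
  shows "\<exists>S\<subseteq>V. real (card S) \<le> real (card V) / 2 \<and> (1 - \<epsilon>) * real (card V) \<le> 2 * real (card S) \<and>
    (\<forall>u\<in>S. \<forall>v\<in>V - S. T u \<noteq> T v)"
proof -
  let ?P = "\<lambda>S. S \<subseteq> V \<and> real (card S) \<le> real (card V) / 2 \<and> (\<forall>u\<in>S. \<forall>v\<in>V - S. T u \<noteq> T v)"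
  have "?P {}" by simp
  moreover have "\<forall>S. ?P S \<longrightarrow> card S < Suc (card V)"
    using assms by (auto simp: less_Suc_eq_le intro: card_mono)
  ultimately have "\<exists>S. ?P S \<and> (\<forall>S'. ?P S' \<longrightarrow> card S' \<le> card S)"
    by (rule Lattices_Big.ex_has_greatest_nat)
  then obtain S where S: "?P S" and max: "\<And>S'. ?P S' \<Longrightarrow> card S' \<le> card S"
    by metis
  have fin: "finite S" using S assms finite_subset by blast
  have "card V > 0" using assms by auto
  then have "S \<noteq> V" using S by auto
  then obtain w where w: "w \<in> V" "w \<notin> S" using S by blast
  define K where "K = {v \<in> V. T v = T w}"
  have K: "K \<subseteq> V" "w \<in> K" "finite K" "K \<inter> S = {}"
    using assms S w unfolding K_def by auto
  \<comment> \<open>All nodes of \<open>K\<close> share one token set, and it contains each node's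
    own token, so a larger \<open>K\<close> would itself witness solved gossip.\<close>
  have Kcard: "real (card K) < \<epsilon> * real (card V)"
  proof (rule ccontr)
    assume "\<not> ?thesis"
    then have "gossip_solved \<epsilon> V T" unfolding gossip_solved_def
      using assms(3) K(1) by (intro exI[of _ K]) (auto simp: K_def)
    then show False using assms by simp
  qed
  have cSK: "card (S \<union> K) = card S + card K" using K fin by (simp add: card_Un_disjoint Int_commute)
  have "card K > 0" using K card_gt_0_iff by blast
  have closed: "\<forall>u\<in>S \<union> K. \<forall>v\<in>V - (S \<union> K). T u \<noteq> T v" using S unfolding K_def by auto
  have big: "real (card (S \<union> K)) > real (card V) / 2"
  proof -
    have "\<not> card (S \<union> K) \<le> card S" using cSK \<open>card K > 0\<close> by simp
    then show ?thesis using max[of "S \<union> K"] S K(1) closed by (meson Un_least not_le)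
  qed
  have cR: "real (card (V - (S \<union> K))) = real (card V) - real (card (S \<union> K))"
  proof -
    have "finite (S \<union> K)" "S \<union> K \<subseteq> V" using fin K S by auto
    then show ?thesis using card_mono[OF assms(1), of "S \<union> K"]
      by (simp add: card_Diff_subset of_nat_diff del: Un_subset_iff finite_Un)
  qed
  have "?P (V - (S \<union> K))"
  proof (intro conjI ballI)
    fix u v assume "u \<in> V - (S \<union> K)" "v \<in> V - (V - (S \<union> K))"
    then show "T u \<noteq> T v" using closed[rule_format, of v u] by auto
  qed (use big cR in auto)
  \<comment> \<open>By maximality the rest is no larger than \<open>S\<close>, so \<open>S\<close>
    counted twice together with \<open>K\<close> covers all of \<open>V\<close>, and
    \<open>K\<close> is smaller than \<open>\<epsilon> * card V\<close>.\<close>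
  then have "real (card (V - (S \<union> K))) \<le> real (card S)" using max by simp
  then have "(1 - \<epsilon>) * real (card V) \<le> 2 * real (card S)"
    using cR cSK Kcard by (simp add: algebra_simps)
  then show ?thesis using S by blast
qed

text \<open>The balanced cut loses a factor 2 and the matching across it a factor 4. Since
  \<open>a\<close> is any lower bound for the expansion, the parameter of the dynamic graph serves
  for every round.\<close>

lemma unsolved_matching:
  assumes "finite V" "card V > 1" "E \<subseteq> V \<times> V" "0 \<le> a" "a \<le> vertex_expansion V E"
    and "\<And>u. u \<in> V \<Longrightarrow> u \<in> T u" "\<not> gossip_solved \<epsilon> V T"
  shows "\<exists>M\<subseteq>E. inj_on fst M \<and> inj_on snd M \<and> (\<forall>(u, v)\<in>M. T u \<noteq> T v) \<and>
    a * (1 - \<epsilon>) * real (card V) \<le> 8 * real (card M)"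
proof -
  have "V \<noteq> {}" using assms by auto
  then obtain S where S: "S \<subseteq> V" "real (card S) \<le> real (card V) / 2"
    "(1 - \<epsilon>) * real (card V) \<le> 2 * real (card S)" "\<forall>u\<in>S. \<forall>v\<in>V - S. T u \<noteq> T v"
    using unsolved_balanced_cut[of V T \<epsilon>] assms by auto
  have fin: "finite S" using S assms finite_subset by blast
  have expand: "a * real (card S') \<le> real (card (boundary V E S'))" if "S' \<subseteq> S" "S' \<noteq> {}" for S'
  proof -
    have "card S' \<le> card S" using that fin by (simp add: card_mono)
    then have "vertex_expansion V E * real (card S') \<le> real (card (boundary V E S'))"
      using assms S that by (intro vertex_expansion_le) auto
    moreover have "a * real (card S') \<le> vertex_expansion V E * real (card S')"
      using assms by (intro mult_right_mono) auto
    ultimately show ?thesis by simp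
  qed
  have "a \<le> 2" using vertex_expansion_le_2[of V E] assms by simp
  then obtain M where M: "M \<subseteq> E \<inter> (S \<times> (V - S))" "inj_on fst M" "inj_on snd M"
    "a * real (card S) \<le> 4 * real (card M)"
    using cut_matching[OF assms(1,3) S(1) assms(4) _ expand] by blast
  have "a * ((1 - \<epsilon>) * real (card V)) \<le> a * (2 * real (card S))"
    using assms S by (intro mult_left_mono) auto
  then have "a * (1 - \<epsilon>) * real (card V) \<le> 8 * real (card M)" using M by (simp add: mult.assoc)
  then show ?thesis using M S by (intro exI[of _ M]) auto
qed

section \<open>Random proposals\<close>

text \<open>The choosers are independent, so all of them miss \<open>v\<close> with probability
  \<open>\<Prod>(1 - c u)\<close>, at most \<open>exp (- y)\<close> and hence at most
  \<open>1 / (1 + y)\<close>. Allowing any \<open>y\<close> below the total weight lets callers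
  restrict to part of the choosers.\<close>

lemma prob_choice_hit_ge:
  assumes "finite U" "\<And>u. u \<in> U \<Longrightarrow> finite (Z u) \<and> Z u \<noteq> {}"
    and "0 \<le> y" "y \<le> (\<Sum>u\<in>U. of_bool (v \<in> Z u) / real (card (Z u)))"
  shows "y / (1 + y) \<le>
    measure_pmf.prob (Pi_pmf U None (\<lambda>u. map_pmf Some (pmf_of_set (Z u)))) {p. \<exists>u\<in>U. p u = Some v}"
proof -
  let ?q = "\<lambda>u. map_pmf Some (pmf_of_set (Z u))"
  let ?Q = "Pi_pmf U None ?q"
  let ?c = "\<lambda>u. of_bool (v \<in> Z u) / real (card (Z u))"
  have miss: "measure_pmf.prob (?q u) (- {Some v}) = 1 - ?c u" if "u \<in> U" for u
  proof -
    have "measure_pmf.prob (?q u) {Some v} = measure_pmf.prob (pmf_of_set (Z u)) {v}"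
      by (auto simp: measure_map_pmf vimage_def)
    also have "\<dots> = ?c u"
      using assms(2)[OF that] by (simp add: measure_pmf_single indicator_def)
    finally show ?thesis
      using measure_pmf.prob_compl[of "{Some v}" "?q u"] by (simp add: Compl_eq_Diff_UNIV)
  qed
  have c: "0 \<le> ?c u" "?c u \<le> 1" if "u \<in> U" for u
    using assms(2)[OF that] by (auto simp: divide_simps Suc_le_eq card_gt_0_iff)
  have "measure_pmf.prob ?Q (Pi U (\<lambda>_. - {Some v})) = (\<Prod>u\<in>U. 1 - ?c u)"
    using assms(1) miss by (subst measure_Pi_pmf_Pi) (auto intro: prod.cong)
  also have "\<dots> \<le> (\<Prod>u\<in>U. exp (- ?c u))"
  proof (intro prod_mono conjI)
    fix u assume "u \<in> U"
    then show "0 \<le> 1 - ?c u" using c by simp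
    show "1 - ?c u \<le> exp (- ?c u)" using exp_ge_add_one_self[of "- ?c u"] by simp
  qed
  also have "\<dots> = exp (- (\<Sum>u\<in>U. ?c u))" using assms(1) by (simp add: exp_sum flip: sum_negf)
  also have "\<dots> \<le> exp (- y)" using assms by simp
  also have "\<dots> \<le> 1 / (1 + y)" using assms by (intro exp_minus_le)
  finally have "measure_pmf.prob ?Q (Pi U (\<lambda>_. - {Some v})) \<le> 1 / (1 + y)" .
  moreover have "{p. \<exists>u\<in>U. p u = Some v} = UNIV - Pi U (\<lambda>_. - {Some v})" by (auto simp: Pi_def)
  then have "measure_pmf.prob ?Q {p. \<exists>u\<in>U. p u = Some v} =
      1 - measure_pmf.prob ?Q (Pi U (\<lambda>_. - {Some v}))"
    using measure_pmf.prob_compl[of "Pi U (\<lambda>_. - {Some v})" ?Q] by simp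
  moreover have "y / (1 + y) = 1 - 1 / (1 + y)" using assms(3) by (simp add: field_simps)
  ultimately show ?thesis by linarith
qed

text \<open>
  Choosers with at most \<open>sqrt D\<close> options hit their matched partner often enough; the other ones
  put total weight at most \<open>sqrt D\<close> on each single target, hence spread over many targets.
\<close>

lemma matching_le_expected_hits:
  assumes "finite U" "finite W" "\<And>u. u \<in> U \<Longrightarrow> Z u \<subseteq> W \<and> Z u \<noteq> {}" "D \<ge> 1"
    and deg: "\<And>v. v \<in> W \<Longrightarrow> real (card {u \<in> U. v \<in> Z u}) \<le> D"
    and P: "P \<subseteq> Sigma U Z" "inj_on fst P" "inj_on snd P"
  shows "real (card P) \<le> 4 * sqrt D *
    measure_pmf.expectation (Pi_pmf U None (\<lambda>u. map_pmf Some (pmf_of_set (Z u))))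
      (\<lambda>p. real (card {v \<in> W. \<exists>u\<in>U. p u = Some v}))"
proof -
  let ?Q = "Pi_pmf U None (\<lambda>u. map_pmf Some (pmf_of_set (Z u)))"
  let ?c = "\<lambda>u v. of_bool (v \<in> Z u) / real (card (Z u))"
  define s where "s = sqrt D"
  have s: "s \<ge> 1" "s * s = D" using assms(4) unfolding s_def by auto
  have Z: "finite (Z u)" "Z u \<noteq> {}" "card (Z u) > 0" if "u \<in> U" for u
    using assms(2) assms(3)[OF that] by (auto simp: card_gt_0_iff finite_subset)
  define hit where "hit v = measure_pmf.prob ?Q {p. \<exists>u\<in>U. p u = Some v}" for v
  define e where "e = measure_pmf.expectation ?Q (\<lambda>p. real (card {v \<in> W. \<exists>u\<in>U. p u = Some v}))"
  have "finite (set_pmf ?Q)" using assms(1) Z by (intro finite_set_Pi_pmf) auto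
  then have e: "e = (\<Sum>v\<in>W. hit v)"
    unfolding e_def hit_def using assms(2)
    by (subst expectation_card[where V = W]) (auto intro!: sum.cong arg_cong2[where f = measure])
  have hit: "y / (1 + y) \<le> hit v" if "0 \<le> y" "y \<le> (\<Sum>u\<in>U. ?c u v)" for y v
    unfolding hit_def using assms(1) Z that by (intro prob_choice_hit_ge) auto
  \<comment> \<open>Below the level \<open>s\<close> the denominator \<open>1 + y\<close> is at most
    \<open>2 * s\<close>, so the hit probability is linear in the weight and can be summed over
    targets.\<close>
  have hit_ge: "y / (2 * s) \<le> hit v" if "0 \<le> y" "y \<le> s" "y \<le> (\<Sum>u\<in>U. ?c u v)" for y v
  proof -
    have "y / (2 * s) \<le> y / (1 + y)" using that s by (intro divide_left_mono) auto
    also have "\<dots> \<le> hit v" using that by (intro hit)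
    finally show ?thesis .
  qed
  have hit_one: "1 / (2 * s) \<le> hit v" if "1 / s \<le> (\<Sum>u\<in>U. ?c u v)" for v
  proof -
    have "1 / (2 * s) \<le> 1 / s / (1 + 1 / s)" using s by (simp add: divide_simps)
    also have "\<dots> \<le> hit v" using s that by (intro hit) auto
    finally show ?thesis .
  qed
  have hit0: "0 \<le> hit v" for v unfolding hit_def by simp
  define H where "H = {u \<in> U. real (card (Z u)) > s}"
  have finH: "finite H" using assms(1) unfolding H_def by simp
  have finP: "finite P" using P(1) assms(1) Z by (meson finite_SigmaI finite_subset)
  define L where "L = {x \<in> P. fst x \<notin> H}"
  have low: "real (card L) \<le> 2 * s * e"
  proof -
    have "1 / (2 * s) \<le> hit (snd x)" if xL: "x \<in> L" for x
    proof -
      obtain u v where x: "x = (u, v)" "u \<in> U" "v \<in> Z u" "real (card (Z u)) \<le> s"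
        using xL P(1) unfolding L_def H_def by (cases x) auto
      have "1 / s \<le> 1 / real (card (Z u))" using x(4) Z(3)[OF x(2)] s by (intro divide_left_mono) auto
      also have "\<dots> = ?c u v" using x(3) by simp
      also have "\<dots> \<le> (\<Sum>u\<in>U. ?c u v)"
        by (rule member_le_sum[OF x(2) _ assms(1)]) simp
      finally show ?thesis unfolding x(1) snd_conv by (rule hit_one)
    qed
    then have "(\<Sum>x\<in>L. 1 / (2 * s)) \<le> (\<Sum>x\<in>L. hit (snd x))" by (intro sum_mono)
    also have "\<dots> = (\<Sum>v\<in>snd ` L. hit v)"
      using P(3) unfolding L_def by (subst sum.reindex) (auto intro: inj_on_subset)
    also have "\<dots> \<le> e" unfolding e
    proof (intro sum_mono2)
      show "snd ` L \<subseteq> W" using P(1) assms(3) unfolding L_def by fastforce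
    qed (use assms(2) hit0 in auto)
    finally show ?thesis using s by (simp add: field_simps)
  qed
  have high: "real (card H) \<le> 2 * s * e"
  proof -
    \<comment> \<open>A chooser in \<open>H\<close> puts at most \<open>1 / s\<close> on
      \<open>v\<close>, and at most \<open>D\<close> choosers see \<open>v\<close>, so the weight
      stays within \<open>D / s = s\<close> and \<open>hit_ge\<close> applies.\<close>
    have "(\<Sum>u\<in>H. ?c u v) / (2 * s) \<le> hit v" if "v \<in> W" for v
    proof (rule hit_ge)
      have "(\<Sum>u\<in>H. ?c u v) \<le> (\<Sum>u\<in>H. of_bool (v \<in> Z u) / s)"
        using s unfolding H_def by (intro sum_mono divide_left_mono) auto
      also have "\<dots> = real (card {u \<in> H. v \<in> Z u}) / s"
        using finH by (simp add: sum_divide_distrib[symmetric] of_bool_def sum.If_cases Int_def)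
      also have "card {u \<in> H. v \<in> Z u} \<le> card {u \<in> U. v \<in> Z u}"
        using assms(1) unfolding H_def by (intro card_mono) auto
      then have "real (card {u \<in> H. v \<in> Z u}) / s \<le> D / s"
        using deg[OF that] s by (intro divide_right_mono) auto
      finally show "(\<Sum>u\<in>H. ?c u v) \<le> s" using s(1) by (simp flip: s(2))
      show "(\<Sum>u\<in>H. ?c u v) \<le> (\<Sum>u\<in>U. ?c u v)"
        using assms(1) unfolding H_def by (intro sum_mono2) auto
    qed (auto intro: sum_nonneg)
    then have "(\<Sum>v\<in>W. (\<Sum>u\<in>H. ?c u v) / (2 * s)) \<le> e" unfolding e by (intro sum_mono)
    also have "(\<Sum>v\<in>W. (\<Sum>u\<in>H. ?c u v) / (2 * s)) = (\<Sum>v\<in>W. \<Sum>u\<in>H. ?c u v) / (2 * s)"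
      by (rule sum_divide_distrib[symmetric])
    \<comment> \<open>After the swap each chooser contributes its total weight one, so the double
      sum is \<open>card H\<close>.\<close>
    also have "(\<Sum>v\<in>W. \<Sum>u\<in>H. ?c u v) = (\<Sum>u\<in>H. \<Sum>v\<in>W. ?c u v)" by (rule sum.swap)
    also have "(\<Sum>u\<in>H. \<Sum>v\<in>W. ?c u v) = (\<Sum>u\<in>H. 1)"
    proof (intro sum.cong refl)
      fix u assume "u \<in> H"
      then have u: "u \<in> U" unfolding H_def by simp
      then have "{v \<in> W. v \<in> Z u} = Z u" using assms(3) by auto
      then have "(\<Sum>v\<in>W. ?c u v) = real (card (Z u)) / real (card (Z u))"
        using assms(2) by (simp add: sum_divide_distrib[symmetric] of_bool_def sum.If_cases Int_def)
      then show "(\<Sum>v\<in>W. ?c u v) = 1" using Z(3)[OF u] by simp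
    qed
    finally show ?thesis using s by (simp add: field_simps)
  qed
  \<comment> \<open>The remaining pairs have distinct choosers, all of them in
    \<open>H\<close>.\<close>
  have "card (P - L) = card (fst ` (P - L))"
    using P(2) by (intro card_image[symmetric]) (auto intro: inj_on_subset)
  also have "\<dots> \<le> card H" using finH unfolding L_def by (intro card_mono) auto
  finally have "card P \<le> card L + card H"
    using card_Diff_subset[of L P] finP unfolding L_def by (simp add: card_mono)
  then have "real (card P) \<le> 4 * s * e" using low high by simp
  then show ?thesis unfolding s_def e_def .
qed

section \<open>Proposals and acceptors for given shared bits\<close>

lemma tag_cases: "tag \<rho> r T u = 0 \<or> tag \<rho> r T u = 1"
  unfolding tag_def by linarith

lemma finite_zero_neighbors:
  assumes "finite V" "E \<subseteq> V \<times> V"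
  shows "finite (zero_neighbors E \<rho> r T u)" "zero_neighbors E \<rho> r T u \<subseteq> V"
  using assms unfolding zero_neighbors_def by (auto intro: finite_subset[of _ V])

lemma finite_senders: "finite V \<Longrightarrow> finite (senders V E \<rho> r T)"
  unfolding senders_def by simp

lemma finite_set_sharedbit_proposals:
  assumes "finite V" "E \<subseteq> V \<times> V"
  shows "finite (set_pmf (sharedbit_proposals V E \<rho> r T))"
  unfolding sharedbit_proposals_def
  using finite_zero_neighbors[OF assms] finite_senders[OF assms(1)]
  by (intro finite_set_Pi_pmf) (auto simp: senders_def)

lemma sharedbit_proposals_support:
  assumes "finite V" "E \<subseteq> V \<times> V" "p \<in> set_pmf (sharedbit_proposals V E \<rho> r T)"
  shows "u \<notin> senders V E \<rho> r T \<Longrightarrow> p u = None"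
    and "u \<in> senders V E \<rho> r T \<Longrightarrow> \<exists>v\<in>zero_neighbors E \<rho> r T u. p u = Some v"
  using assms(3) finite_zero_neighbors[OF assms(1,2)] finite_senders[OF assms(1)]
  unfolding sharedbit_proposals_def
  by (auto simp: set_Pi_pmf PiE_dflt_def senders_def split: if_splits)

text \<open>A proposal always goes to a node with tag 0, which sends none itself, so every node that
  is proposed to accepts.\<close>

lemma acceptors_sharedbit:
  assumes "finite V" "E \<subseteq> V \<times> V" "p \<in> set_pmf (sharedbit_proposals V E \<rho> r T)"
  shows "acceptors V p = {v \<in> V. \<exists>u\<in>senders V E \<rho> r T. p u = Some v}"
proof (intro equalityI subsetI)
  fix v assume "v \<in> acceptors V p"
  then show "v \<in> {v \<in> V. \<exists>u\<in>senders V E \<rho> r T. p u = Some v}"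
    using sharedbit_proposals_support(1)[OF assms] unfolding acceptors_def by fastforce
next
  fix v assume "v \<in> {v \<in> V. \<exists>u\<in>senders V E \<rho> r T. p u = Some v}"
  then obtain u where u: "v \<in> V" "u \<in> senders V E \<rho> r T" "p u = Some v" by blast
  then have "v \<in> zero_neighbors E \<rho> r T u" using sharedbit_proposals_support(2)[OF assms] by fastforce
  then have "v \<notin> senders V E \<rho> r T" unfolding senders_def zero_neighbors_def by simp
  then show "v \<in> acceptors V p"
    using u sharedbit_proposals_support(1)[OF assms] unfolding acceptors_def senders_def by auto
qed

text \<open>Instance of \<open>matching_le_expected_hits\<close> with the senders as choosers. By
  symmetry of the graph, the senders that may choose \<open>v\<close> are neighbors of
  \<open>v\<close>, so the degree bound is the required \<open>D\<close>.\<close>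

lemma zero_pairs_le_expected_acceptors:
  assumes "finite V" "E \<subseteq> V \<times> V" "sym E" "D \<ge> 1"
    and "\<And>v. v \<in> V \<Longrightarrow> real (card (E `` {v})) \<le> D"
    and "P \<subseteq> E" "inj_on fst P" "inj_on snd P"
    and "\<And>u v. (u, v) \<in> P \<Longrightarrow> tag \<rho> r T u = 1 \<and> tag \<rho> r T v = 0"
  shows "real (card P) \<le> 4 * sqrt D *
    measure_pmf.expectation (sharedbit_proposals V E \<rho> r T) (\<lambda>p. real (card (acceptors V p)))"
proof -
  let ?Q = "sharedbit_proposals V E \<rho> r T"
  let ?U = "senders V E \<rho> r T"
  have deg: "real (card {u \<in> ?U. v \<in> zero_neighbors E \<rho> r T u}) \<le> D" if "v \<in> V" for v
  proof -
    have "{u \<in> ?U. v \<in> zero_neighbors E \<rho> r T u} \<subseteq> E `` {v}"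
      using assms(3) unfolding zero_neighbors_def by (auto dest: symD)
    moreover have "finite (E `` {v})" using assms by (auto intro: finite_subset[of _ V])
    ultimately have "card {u \<in> ?U. v \<in> zero_neighbors E \<rho> r T u} \<le> card (E `` {v})"
      by (intro card_mono)
    then show ?thesis using assms(5)[OF that] by linarith
  qed
  have "P \<subseteq> Sigma ?U (zero_neighbors E \<rho> r T)"
    using assms(2,6,9) unfolding senders_def zero_neighbors_def by fastforce
  then have "real (card P) \<le> 4 * sqrt D *
      measure_pmf.expectation ?Q (\<lambda>p. real (card {v \<in> V. \<exists>u\<in>?U. p u = Some v}))"
    unfolding sharedbit_proposals_def
    using assms deg finite_zero_neighbors[OF assms(1,2)] finite_senders[OF assms(1)]
    by (intro matching_le_expected_hits) (auto simp: senders_def)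
  also have "measure_pmf.expectation ?Q (\<lambda>p. real (card {v \<in> V. \<exists>u\<in>?U. p u = Some v})) =
      measure_pmf.expectation ?Q (\<lambda>p. real (card (acceptors V p)))"
    using acceptors_sharedbit[OF assms(1,2)]
    by (intro integral_cong_AE) (auto simp: AE_measure_pmf_iff)
  finally show ?thesis .
qed

text \<open>Split the edges by which endpoint has tag 1 and reverse those of the second kind. Either
  kind is a matching to which the previous bound applies, hence 8 in place of 4.\<close>

lemma differing_le_expected_acceptors:
  assumes "finite V" "E \<subseteq> V \<times> V" "sym E" "D \<ge> 1"
    and "\<And>v. v \<in> V \<Longrightarrow> real (card (E `` {v})) \<le> D"
    and "M \<subseteq> E" "inj_on fst M" "inj_on snd M"
  shows "real (card {e \<in> M. tag \<rho> r T (fst e) \<noteq> tag \<rho> r T (snd e)}) \<le> 8 * sqrt D *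
    measure_pmf.expectation (sharedbit_proposals V E \<rho> r T) (\<lambda>p. real (card (acceptors V p)))"
proof -
  let ?M1 = "{e \<in> M. tag \<rho> r T (fst e) = 1 \<and> tag \<rho> r T (snd e) = 0}"
  let ?M2 = "{e \<in> M. tag \<rho> r T (fst e) = 0 \<and> tag \<rho> r T (snd e) = 1}"
  let ?N2 = "prod.swap ` ?M2"
  have finM: "finite M" using assms by (meson finite_SigmaI finite_subset)
  have "{e \<in> M. tag \<rho> r T (fst e) \<noteq> tag \<rho> r T (snd e)} = ?M1 \<union> ?M2"
  proof (intro set_eqI)
    fix e
    show "e \<in> {e \<in> M. tag \<rho> r T (fst e) \<noteq> tag \<rho> r T (snd e)} \<longleftrightarrow> e \<in> ?M1 \<union> ?M2"
      using tag_cases[of \<rho> r T "fst e"] tag_cases[of \<rho> r T "snd e"] by auto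
  qed
  then have "card {e \<in> M. tag \<rho> r T (fst e) \<noteq> tag \<rho> r T (snd e)} \<le> card ?M1 + card ?M2"
    by (simp add: card_Un_le)
  moreover have "card ?N2 = card ?M2" by (intro card_image) simp
  moreover have "real (card ?M1) \<le> 4 * sqrt D *
      measure_pmf.expectation (sharedbit_proposals V E \<rho> r T) (\<lambda>p. real (card (acceptors V p)))"
    using assms by (intro zero_pairs_le_expected_acceptors) (auto intro: inj_on_subset)
  moreover have "real (card ?N2) \<le> 4 * sqrt D *
      measure_pmf.expectation (sharedbit_proposals V E \<rho> r T) (\<lambda>p. real (card (acceptors V p)))"
  proof (intro zero_pairs_le_expected_acceptors assms(1-5))
    show "?N2 \<subseteq> E" using assms(3,6) by (auto dest: symD)
    have "inj_on (fst \<circ> prod.swap) ?M2" "inj_on (snd \<circ> prod.swap) ?M2"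
      using inj_on_subset[OF assms(8)] inj_on_subset[OF assms(7)] by (auto simp: comp_def)
    then show "inj_on fst ?N2" "inj_on snd ?N2" by (auto dest: inj_on_imageI)
  qed auto
  ultimately show ?thesis by linarith
qed

text \<open>The endpoint with tag 1 has a neighbor with tag 0, so it sends a proposal, and whichever
  node receives it is an acceptor in every outcome.\<close>

lemma differing_edge_acceptor:
  assumes "finite V" "E \<subseteq> V \<times> V" "sym E" "(u, v) \<in> E" "tag \<rho> r T u \<noteq> tag \<rho> r T v"
  shows "1 \<le> measure_pmf.expectation (sharedbit_proposals V E \<rho> r T) (\<lambda>p. real (card (acceptors V p)))"
proof -
  obtain x y where xy: "(x, y) \<in> E" "tag \<rho> r T x = 1" "tag \<rho> r T y = 0"
    using assms tag_cases[of \<rho> r T] by (metis symD)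
  then have x: "x \<in> senders V E \<rho> r T"
    using assms(2) unfolding senders_def zero_neighbors_def by auto
  have "1 \<le> real (card (acceptors V p))" if p: "p \<in> set_pmf (sharedbit_proposals V E \<rho> r T)" for p
  proof -
    obtain w where "w \<in> zero_neighbors E \<rho> r T x" "p x = Some w"
      using sharedbit_proposals_support(2)[OF assms(1,2) p x] by blast
    then have "w \<in> acceptors V p"
      using acceptors_sharedbit[OF assms(1,2) p] x finite_zero_neighbors[OF assms(1,2)] by blast
    moreover have "finite (acceptors V p)" using assms unfolding acceptors_def by simp
    ultimately show ?thesis by (simp add: Suc_le_eq card_gt_0_iff) blast
  qed
  then have "measure_pmf.expectation (sharedbit_proposals V E \<rho> r T) (\<lambda>_. 1) \<le>
      measure_pmf.expectation (sharedbit_proposals V E \<rho> r T) (\<lambda>p. real (card (acceptors V p)))"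
    using finite_set_sharedbit_proposals[OF assms(1,2)] by (intro expectation_mono_finite) auto
  then show ?thesis by simp
qed

section \<open>Shared bits and token transfer\<close>

lemma tag_flip:
  assumes "finite (T u)"
  shows "tag (\<rho>((r, t, 0) := \<not> \<rho> (r, t, 0))) r T u =
    (if t \<in> T u then 1 - tag \<rho> r T u else tag \<rho> r T u)"
proof (cases "t \<in> T u")
  case True
  let ?b = "\<rho> (r, t, 0)" and ?s = "\<Sum>x\<in>T u - {t}. of_bool (\<rho> (r, x, 0)) :: nat"
  have "(\<Sum>x\<in>T u - {t}. of_bool ((\<rho>((r, t, 0) := \<not> ?b)) (r, x, 0))) = ?s"
    by (intro sum.cong) auto
  then have "(\<Sum>x\<in>T u. of_bool ((\<rho>((r, t, 0) := \<not> ?b)) (r, x, 0))) = of_bool (\<not> ?b) + ?s"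
    by (simp only: sum.remove[OF assms True] fun_upd_same)
  moreover have "(\<Sum>x\<in>T u. of_bool (\<rho> (r, x, 0))) = of_bool ?b + ?s"
    by (simp only: sum.remove[OF assms True])
  moreover have "(of_bool (\<not> b) + s) mod 2 = 1 - (of_bool b + s) mod 2" for b and s :: nat
    by (cases b) (simp_all, presburger+)
  ultimately show ?thesis using True unfolding tag_def by simp
next
  case False
  then have "(\<Sum>x\<in>T u. of_bool ((\<rho>((r, t, 0) := \<not> \<rho> (r, t, 0))) (r, x, 0))) =
      (\<Sum>x\<in>T u. of_bool (\<rho> (r, x, 0)) :: nat)"
    by (intro sum.cong) auto
  then show ?thesis using False unfolding tag_def by simp
qed

text \<open>A finite product of fair coins is uniform on a finite set of functions, and flipping one
  coordinate is an involution of that set.\<close>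

lemma Pi_pmf_coin_flip:
  assumes "finite I" "i \<in> I"
  shows "map_pmf (\<lambda>\<rho>. \<rho>(i := \<not> \<rho> i)) (Pi_pmf I False (\<lambda>_. pmf_of_set (UNIV :: bool set))) =
    Pi_pmf I False (\<lambda>_. pmf_of_set UNIV)"
proof -
  let ?A = "PiE_dflt I False (\<lambda>_. UNIV :: bool set)" and ?f = "\<lambda>\<rho>. \<rho>(i := \<not> \<rho> i)"
  have "bij_betw ?f ?A ?A"
    using assms(2) by (intro bij_betwI[where g = ?f]) (auto simp: PiE_dflt_def)
  then have "map_pmf ?f (pmf_of_set ?A) = pmf_of_set ?A"
    using assms by (intro map_pmf_of_set_bij_betw) auto
  then show ?thesis using assms by (simp add: Pi_pmf_of_set)
qed

lemma finite_set_shared_string: "finite (set_pmf (shared_string c N))"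
  unfolding shared_string_def by (intro finite_set_Pi_pmf) auto

text \<open>Some token \<open>t\<close> is known to exactly one of the two nodes. Flipping its bit
  changes exactly one of the tags and preserves the distribution, so the event is as likely as its
  complement.\<close>

lemma prob_tag_differ:
  assumes "T u \<subseteq> {1..N}" "T v \<subseteq> {1..N}" "T u \<noteq> T v" "1 \<le> r" "r \<le> c * N\<^sup>2"
  shows "measure_pmf.prob (shared_string c N) {\<rho>. tag \<rho> r T u \<noteq> tag \<rho> r T v} = 1 / 2"
proof -
  let ?S = "shared_string c N" and ?D = "{\<rho>. tag \<rho> r T u \<noteq> tag \<rho> r T v}"
  obtain t where t: "t \<in> T u \<longleftrightarrow> t \<notin> T v" "t \<in> {1..N}" using assms(1-3) by blast
  let ?f = "\<lambda>\<rho> :: bit_string. \<rho>((r, t, 0) := \<not> \<rho> (r, t, 0))"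
  have fin: "finite (T u)" "finite (T v)" using assms(1,2) finite_subset by blast+
  have "tag (?f \<rho>) r T u \<noteq> tag (?f \<rho>) r T v \<longleftrightarrow> \<not> (tag \<rho> r T u \<noteq> tag \<rho> r T v)" for \<rho>
    using tag_cases[of \<rho> r T u] tag_cases[of \<rho> r T v] t(1)
    unfolding tag_flip[of T u, OF fin(1)] tag_flip[of T v, OF fin(2)] by auto
  then have "?f -` ?D = UNIV - ?D" by auto
  moreover have "map_pmf ?f ?S = ?S"
    unfolding shared_string_def using assms t(2) by (intro Pi_pmf_coin_flip) auto
  then have "measure_pmf.prob ?S ?D = measure_pmf.prob ?S (?f -` ?D)"
    using measure_map_pmf[of ?f ?S ?D] by simp
  ultimately have "measure_pmf.prob ?S ?D = 1 - measure_pmf.prob ?S ?D"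
    using measure_pmf.prob_compl[of ?D ?S] by simp
  then show ?thesis by simp
qed

section \<open>Acceptances, exchanges and tokens gained in one round\<close>

lemma finite_acceptors: "finite V \<Longrightarrow> finite (acceptors V p)"
  unfolding acceptors_def by simp

lemma acceptances_support:
  assumes "finite V" "a \<in> set_pmf (acceptances V p)"
  shows "v \<notin> acceptors V p \<Longrightarrow> a v = None"
    and "v \<in> acceptors V p \<Longrightarrow> \<exists>u\<in>V. p u = Some v \<and> a v = Some u"
proof -
  have "{u \<in> V. p u = Some v} \<noteq> {}" if "v \<in> acceptors V p" for v
    using that unfolding acceptors_def by auto
  then show "v \<notin> acceptors V p \<Longrightarrow> a v = None"
    and "v \<in> acceptors V p \<Longrightarrow> \<exists>u\<in>V. p u = Some v \<and> a v = Some u"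
    using assms finite_acceptors[OF assms(1), of p]
    unfolding acceptances_def by (force simp: set_Pi_pmf PiE_dflt_def)+
qed

lemma finite_set_acceptances:
  assumes "finite V"
  shows "finite (set_pmf (acceptances V p))"
  unfolding acceptances_def
proof (intro finite_set_Pi_pmf finite_acceptors assms)
  fix v assume "v \<in> acceptors V p"
  then have "{u \<in> V. p u = Some v} \<noteq> {}" unfolding acceptors_def by auto
  then show "finite (set_pmf (map_pmf Some (pmf_of_set {u \<in> V. p u = Some v})))"
    using assms by simp
qed

definition gossip_state :: "node set \<Rightarrow> state \<Rightarrow> bool" where
  "gossip_state V T \<longleftrightarrow> (\<forall>u\<in>V. u \<in> T u \<and> T u \<subseteq> V)"

definition token_count :: "node set \<Rightarrow> state \<Rightarrow> nat" where
  "token_count V T = (\<Sum>u\<in>V. card (T u))"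

text \<open>What the analysis of exchanges takes from the tags: every proposal joins nodes that have
  something to transfer.\<close>

definition productive :: "node set \<Rightarrow> state \<Rightarrow> (node \<Rightarrow> node option) \<Rightarrow> bool" where
  "productive V T p \<longleftrightarrow> (\<forall>u v. p u = Some v \<longrightarrow> u \<in> V \<and> v \<in> V \<and> u \<noteq> v \<and> T u \<noteq> T v)"

definition successes ::
    "node set \<Rightarrow> state \<Rightarrow> (node \<Rightarrow> node option) \<Rightarrow> (node \<Rightarrow> node option) \<Rightarrow>
      (node \<Rightarrow> token set \<times> token set) \<Rightarrow> node set" where
  "successes V T p a x = {v \<in> acceptors V p.
     Min ((T (the (a v)) \<union> T v) - (T (the (a v)) \<inter> T v)) \<in> fst (x v) \<inter> snd (x v)}"

context
  fixes q :: nat and V :: "node set" and \<delta> :: real and X :: subroutine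
  assumes finV: "finite V" and X: "is_transfer q V \<delta> X" and \<delta>: "\<delta> \<le> 1 / 2"
begin

lemma transfer_support:
  assumes "u \<in> V" "v \<in> V" "u \<noteq> v" "A \<subseteq> V" "B \<subseteq> V" "y \<in> set_pmf (X u v A B)"
  shows "A \<subseteq> fst y" "fst y \<subseteq> A \<union> B" "B \<subseteq> snd y" "snd y \<subseteq> A \<union> B"
proof -
  have "\<forall>(A', B')\<in>set_pmf (X u v A B).
      A \<subseteq> A' \<and> A' \<subseteq> A \<union> B \<and> B \<subseteq> B' \<and> B' \<subseteq> A \<union> B \<and> card (A' - A) + card (B' - B) \<le> q"
    using X[unfolded is_transfer_def, THEN bspec, OF assms(1), THEN bspec, OF assms(2),
      THEN spec, of A, THEN spec, of B, THEN mp] assms(3-5) by simp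
  then have "A \<subseteq> fst y \<and> fst y \<subseteq> A \<union> B \<and> B \<subseteq> snd y \<and> snd y \<subseteq> A \<union> B"
    using assms(6) by (auto simp: case_prod_beta)
  then show "A \<subseteq> fst y" "fst y \<subseteq> A \<union> B" "B \<subseteq> snd y" "snd y \<subseteq> A \<union> B" by auto
qed

lemma finite_set_transfer:
  assumes "u \<in> V" "v \<in> V" "u \<noteq> v" "A \<subseteq> V" "B \<subseteq> V"
  shows "finite (set_pmf (X u v A B))"
proof (rule finite_subset)
  show "set_pmf (X u v A B) \<subseteq> Pow V \<times> Pow V"
  proof
    fix y assume "y \<in> set_pmf (X u v A B)"
    from transfer_support[OF assms this] show "y \<in> Pow V \<times> Pow V"
      using assms(4,5) by (cases y) auto
  qed
qed (use finV in simp)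

lemma transfer_success:
  assumes "u \<in> V" "v \<in> V" "u \<noteq> v" "A \<subseteq> V" "B \<subseteq> V" "A \<noteq> B"
  shows "1 / 2 \<le> measure_pmf.prob (X u v A B) {y. Min ((A \<union> B) - (A \<inter> B)) \<in> fst y \<inter> snd y}"
proof -
  have "{(A', B'). Min ((A \<union> B) - (A \<inter> B)) \<in> A' \<inter> B'} = {y. Min ((A \<union> B) - (A \<inter> B)) \<in> fst y \<inter> snd y}"
    by auto
  moreover have "1 - \<delta> \<le> measure_pmf.prob (X u v A B) {(A', B'). Min ((A \<union> B) - (A \<inter> B)) \<in> A' \<inter> B'}"
    using X[unfolded is_transfer_def, THEN bspec, OF assms(1), THEN bspec, OF assms(2),
      THEN spec, of A, THEN spec, of B, THEN mp] assms(3-6) by simp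
  ultimately show ?thesis using \<delta> by simp
qed

context
  fixes T :: state and p a :: "node \<Rightarrow> node option"
  assumes T: "gossip_state V T" and p: "productive V T p" and a: "a \<in> set_pmf (acceptances V p)"
begin

lemma acceptor_cases:
  assumes "v \<in> acceptors V p"
  obtains u where "a v = Some u" "p u = Some v" "u \<in> V" "v \<in> V" "u \<noteq> v" "T u \<noteq> T v"
    "T u \<subseteq> V" "T v \<subseteq> V" "p v = None"
proof -
  obtain u where u: "p u = Some v" "a v = Some u" "u \<in> V"
    using acceptances_support(2)[OF finV a assms] by blast
  then have "u \<in> V" "v \<in> V" "u \<noteq> v" "T u \<noteq> T v" using p unfolding productive_def by auto
  moreover have "p v = None" using assms unfolding acceptors_def by simp
  ultimately show ?thesis using u T that unfolding gossip_state_def by blast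
qed

lemma finite_set_exchanges: "finite (set_pmf (exchanges X V p a T))"
  unfolding exchanges_def
proof (intro finite_set_Pi_pmf finite_acceptors finV)
  fix v assume "v \<in> acceptors V p"
  then show "finite (set_pmf (X (the (a v)) v (T (the (a v))) (T v)))"
    by (cases rule: acceptor_cases) (simp add: finite_set_transfer)
qed

lemma exchanges_support:
  assumes x: "x \<in> set_pmf (exchanges X V p a T)" and v: "v \<in> acceptors V p"
  shows "T (the (a v)) \<subseteq> fst (x v)" "fst (x v) \<subseteq> V" "T v \<subseteq> snd (x v)" "snd (x v) \<subseteq> V"
proof -
  have "x v \<in> set_pmf (X (the (a v)) v (T (the (a v))) (T v))"
    using x v finite_acceptors[OF finV] unfolding exchanges_def
    by (auto simp: set_Pi_pmf PiE_dflt_def)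
  moreover obtain u where u: "a v = Some u" "u \<in> V" "v \<in> V" "u \<noteq> v" "T u \<subseteq> V" "T v \<subseteq> V"
    using v by (rule acceptor_cases)
  ultimately have "x v \<in> set_pmf (X u v (T u) (T v))" by simp
  note tr = transfer_support[OF u(2-6) this]
  show "T (the (a v)) \<subseteq> fst (x v)" "T v \<subseteq> snd (x v)" using tr u(1) by simp_all
  show "fst (x v) \<subseteq> V" "snd (x v) \<subseteq> V" using tr u(5,6) by blast+
qed

lemma accepted_is_acceptor: "a v \<noteq> None \<Longrightarrow> v \<in> acceptors V p"
  using acceptances_support(1)[OF finV a] by metis

lemma update_grows:
  assumes "x \<in> set_pmf (exchanges X V p a T)" "w \<in> V"
  shows "T w \<subseteq> update p a x T w" "update p a x T w \<subseteq> V"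
proof -
  have *: "T w \<subseteq> update p a x T w \<and> update p a x T w \<subseteq> V"
  proof (cases "a w")
    case (Some u)
    then have "w \<in> acceptors V p" using accepted_is_acceptor by simp
    then show ?thesis using Some exchanges_support[OF assms(1)] unfolding update_def by simp
  next
    case None
    show ?thesis
    proof (cases "\<exists>v. p w = Some v \<and> a v = Some w")
      case True
      then obtain v where v: "p w = Some v" "a v = Some w" by blast
      then have "v \<in> acceptors V p" using accepted_is_acceptor by simp
      then show ?thesis using None v exchanges_support[OF assms(1), of v] unfolding update_def by simp
    next
      case False
      then have "update p a x T w = T w" using None unfolding update_def by (auto split: option.split)
      then show ?thesis using T assms(2) unfolding gossip_state_def by simp
    qed
  qed
  then show "T w \<subseteq> update p a x T w" "update p a x T w \<subseteq> V" by auto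
qed

lemma gossip_state_update:
  assumes "x \<in> set_pmf (exchanges X V p a T)"
  shows "gossip_state V (update p a x T)"
  using update_grows[OF assms] T unfolding gossip_state_def by blast

text \<open>
  A success enlarges the token set of the acceptor or of its proposer, and each node takes part
  in at most one connection.
\<close>

lemma token_count_update:
  assumes "x \<in> set_pmf (exchanges X V p a T)"
  shows "token_count V T + card (successes V T p a x) \<le> token_count V (update p a x T)"
proof -
  let ?T' = "update p a x T"
  define G where "G = {w \<in> V. T w \<noteq> ?T' w}"
  \<comment> \<open>Charges a success to a node that gained a token: the acceptor if it grew,
    otherwise its proposer.\<close>
  define w where "w v = (if T v \<noteq> ?T' v then v else the (a v))" for v
  have finS: "finite (successes V T p a x)"
    using finite_acceptors[OF finV] unfolding successes_def by simp
  have "w ` successes V T p a x \<subseteq> G"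
  proof
    fix y assume "y \<in> w ` successes V T p a x"
    then obtain v where v: "v \<in> successes V T p a x" "y = w v" by blast
    then have "v \<in> acceptors V p" unfolding successes_def by simp
    then obtain u where u: "a v = Some u" "p u = Some v" "u \<in> V" "v \<in> V" "u \<noteq> v" "T u \<noteq> T v"
      "T u \<subseteq> V" "T v \<subseteq> V" "p v = None" by (rule acceptor_cases)
    let ?D = "(T u \<union> T v) - (T u \<inter> T v)"
    \<comment> \<open>A proposer never accepts, so \<open>update\<close> gives \<open>u\<close> the
      first component of the exchange held at \<open>v\<close>.\<close>
    have "a u = None" using accepted_is_acceptor[of u] u(2) unfolding acceptors_def by (cases "a u") auto
    then have upd: "?T' v = snd (x v)" "?T' u = fst (x v)" using u unfolding update_def by auto
    have "finite ?D" using u(7,8) finV by (auto intro: finite_subset[of _ V])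
    moreover have "?D \<noteq> {}" using u(6) by blast
    ultimately have "Min ?D \<in> ?D" by (rule Min_in)
    moreover have "Min ?D \<in> fst (x v) \<inter> snd (x v)" using v(1) u(1) unfolding successes_def by simp
    ultimately have "T v \<noteq> ?T' v \<or> T u \<noteq> ?T' u" unfolding upd by blast
    then show "y \<in> G" using u unfolding v(2) w_def G_def by auto
  qed
  moreover have "inj_on w (successes V T p a x)"
  proof (rule inj_onI)
    fix v v' assume vv: "v \<in> successes V T p a x" "v' \<in> successes V T p a x" "w v = w v'"
    then have "v \<in> acceptors V p" "v' \<in> acceptors V p" unfolding successes_def by auto
    then obtain u u' where "a v = Some u" "p u = Some v" "p v = None"
      "a v' = Some u'" "p u' = Some v'" "p v' = None" by (metis acceptor_cases)
    \<comment> \<open>The charged node is either an acceptor, which proposes nothing, or a proposer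
      whose proposal names \<open>v\<close>; in both cases it determines \<open>v\<close>.\<close>
    then show "v = v'" using vv(3) unfolding w_def by (auto split: if_splits)
  qed
  ultimately have "card (successes V T p a x) \<le> card G"
    using finV unfolding G_def by (intro card_inj_on_le) auto
  moreover have "token_count V T + card G \<le> token_count V ?T'"
  proof -
    have "token_count V T + card G = (\<Sum>u\<in>V. card (T u) + of_bool (T u \<noteq> ?T' u))"
      using finV unfolding token_count_def G_def sum.distrib
      by (simp add: of_bool_def sum.If_cases Int_def)
    also have "\<dots> \<le> token_count V ?T'"
      unfolding token_count_def
    proof (intro sum_mono)
      fix u assume u: "u \<in> V"
      have "finite (?T' u)" using update_grows[OF assms u] finV finite_subset by blast
      then show "card (T u) + of_bool (T u \<noteq> ?T' u) \<le> card (?T' u)"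
        using update_grows(1)[OF assms u] psubset_card_mono[of "?T' u" "T u"]
        by (cases "T u = ?T' u") (auto simp: Suc_le_eq)
    qed
    finally show ?thesis .
  qed
  ultimately show ?thesis by linarith
qed

text \<open>The exchange at an acceptor is one component of the product, and the two token sets
  differ because the proposal is productive, so it succeeds with probability at least
  \<open>1 - \<delta>\<close>, hence at least one half.\<close>

lemma expected_successes:
  "real (card (acceptors V p)) / 2 \<le>
    measure_pmf.expectation (exchanges X V p a T) (\<lambda>x. real (card (successes V T p a x)))"
proof -
  have "(\<Sum>v\<in>acceptors V p. 1 / 2) \<le>
      (\<Sum>v\<in>acceptors V p. measure_pmf.prob (exchanges X V p a T) {x. v \<in> successes V T p a x})"
  proof (intro sum_mono)
    fix v assume v: "v \<in> acceptors V p"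
    let ?m = "Min ((T (the (a v)) \<union> T v) - (T (the (a v)) \<inter> T v))"
    have "{x. v \<in> successes V T p a x} = {x. ?m \<in> fst (x v) \<inter> snd (x v)}"
      using v unfolding successes_def by simp
    then have "measure_pmf.prob (exchanges X V p a T) {x. v \<in> successes V T p a x} =
        measure_pmf.prob (X (the (a v)) v (T (the (a v))) (T v)) {y. ?m \<in> fst y \<inter> snd y}"
      unfolding exchanges_def
      using prob_Pi_pmf_component[OF finite_acceptors[OF finV] v, where P = "\<lambda>y. ?m \<in> fst y \<inter> snd y"]
      by simp
    also have "\<dots> \<ge> 1 / 2"
    proof -
      obtain u where u: "a v = Some u" "u \<in> V" "v \<in> V" "u \<noteq> v" "T u \<subseteq> V" "T v \<subseteq> V" "T u \<noteq> T v"
        using v by (rule acceptor_cases)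
      show ?thesis using transfer_success[OF u(2-7)] by (simp only: u(1) option.sel)
    qed
    finally show "1 / 2 \<le> measure_pmf.prob (exchanges X V p a T) {x. v \<in> successes V T p a x}" .
  qed
  also have "\<dots> = measure_pmf.expectation (exchanges X V p a T) (\<lambda>x. real (card (successes V T p a x)))"
    using finite_set_exchanges finite_acceptors[OF finV]
    by (intro expectation_card[symmetric]) (auto simp: successes_def)
  finally show ?thesis by simp
qed

end

end

section \<open>Decay of the exponential weight in one round\<close>

definition weight :: "node set \<Rightarrow> state \<Rightarrow> real" where
  "weight V T = exp (- real (token_count V T) / real (card V))"

context
  fixes q :: nat and V :: "node set" and \<delta> :: real and X :: subroutine
  assumes finV: "finite V" and X: "is_transfer q V \<delta> X" and \<delta>: "\<delta> \<le> 1 / 2" and V: "V \<noteq> {}"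
begin

lemma weight_update_le:
  assumes "gossip_state V T" "productive V T p" "a \<in> set_pmf (acceptances V p)"
    and "x \<in> set_pmf (exchanges X V p a T)"
  shows "weight V (update p a x T) \<le>
    weight V T * (1 - real (card (successes V T p a x)) / (2 * real (card V)))"
proof -
  let ?n = "real (card V)" and ?s = "real (card (successes V T p a x))"
  have n: "?n > 0" using finV V by (simp add: card_gt_0_iff)
  have "card (successes V T p a x) \<le> card V"
    using finV unfolding successes_def acceptors_def by (intro card_mono) auto
  \<comment> \<open>A round has at most \<open>card V\<close> successes, so the normalization in
    \<open>weight\<close> puts the exponent into the range of
    \<open>exp_minus_le_half\<close>.\<close>
  then have y: "0 \<le> ?s / ?n" "?s / ?n \<le> 1" using n by simp_all
  have "weight V (update p a x T) \<le> exp (- (real (token_count V T) + ?s) / ?n)"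
    unfolding weight_def using token_count_update[OF finV X \<delta> assms] n
    by (simp add: divide_right_mono flip: of_nat_add)
  also have "\<dots> = weight V T * exp (- (?s / ?n))"
    unfolding weight_def by (simp add: diff_divide_distrib flip: exp_add)
  also have "\<dots> \<le> weight V T * (1 - ?s / ?n / 2)"
    using y by (intro mult_left_mono exp_minus_le_half) (simp_all add: weight_def)
  finally show ?thesis by (simp add: mult.commute)
qed

text \<open>The 4 combines the success probability one half with the slope one half of the linear
  bound on the exponential.\<close>

lemma expected_weight_exchanges:
  assumes "gossip_state V T" "productive V T p" "a \<in> set_pmf (acceptances V p)"
  shows "measure_pmf.expectation (exchanges X V p a T) (\<lambda>x. weight V (update p a x T)) \<le>
    weight V T * (1 - real (card (acceptors V p)) / (4 * real (card V)))"
proof -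
  let ?n = "real (card V)" and ?s = "\<lambda>x. real (card (successes V T p a x))"
  let ?Q = "exchanges X V p a T"
  have n: "?n > 0" using finV V by (simp add: card_gt_0_iff)
  note fin = finite_set_exchanges[OF finV X \<delta> assms]
  have "measure_pmf.expectation ?Q (\<lambda>x. weight V (update p a x T)) \<le>
      measure_pmf.expectation ?Q (\<lambda>x. weight V T * (1 - ?s x / (2 * ?n)))"
    using fin weight_update_le[OF assms] by (intro expectation_mono_finite)
  also have "\<dots> = weight V T * (1 - measure_pmf.expectation ?Q ?s / (2 * ?n))"
    using fin by (simp add: integrable_measure_pmf_finite)
  also have "\<dots> \<le> weight V T * (1 - real (card (acceptors V p)) / 2 / (2 * ?n))"
    using expected_successes[OF finV X \<delta> assms] n
    by (intro mult_left_mono diff_left_mono divide_right_mono) (auto simp: weight_def)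
  finally show ?thesis by simp
qed

lemma mtm_round_support:
  assumes "gossip_state V T" "\<And>p. p \<in> set_pmf Q \<Longrightarrow> productive V T p"
  shows "T' \<in> set_pmf (mtm_round V X Q T) \<Longrightarrow> gossip_state V T'"
    and "finite (set_pmf Q) \<Longrightarrow> finite (set_pmf (mtm_round V X Q T))"
  using gossip_state_update[OF finV X \<delta> assms] finite_set_exchanges[OF finV X \<delta> assms]
    finite_set_acceptances[OF finV]
  unfolding mtm_round_def by auto

lemma expected_weight_mtm_round:
  assumes "gossip_state V T" "\<And>p. p \<in> set_pmf Q \<Longrightarrow> productive V T p" "finite (set_pmf Q)"
  shows "measure_pmf.expectation (mtm_round V X Q T) (weight V) \<le> weight V T *
    (1 - measure_pmf.expectation Q (\<lambda>p. real (card (acceptors V p))) / (4 * real (card V)))"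
proof -
  let ?n = "real (card V)"
  note fin = finite_set_acceptances[OF finV] finite_set_exchanges[OF finV X \<delta> assms(1,2)]
  have "measure_pmf.expectation (mtm_round V X Q T) (weight V) =
      measure_pmf.expectation Q (\<lambda>p. measure_pmf.expectation (acceptances V p) (\<lambda>a.
        measure_pmf.expectation (exchanges X V p a T) (\<lambda>x. weight V (update p a x T))))"
    unfolding mtm_round_def using assms(3) fin
    by (simp add: expectation_bind_finite cong: expectation_cong)
  also have "\<dots> \<le> measure_pmf.expectation Q (\<lambda>p. measure_pmf.expectation (acceptances V p) (\<lambda>a.
        weight V T * (1 - real (card (acceptors V p)) / (4 * ?n))))"
    using assms fin by (intro expectation_mono_finite expected_weight_exchanges) auto
  also have "\<dots> = weight V T *
      (1 - measure_pmf.expectation Q (\<lambda>p. real (card (acceptors V p))) / (4 * ?n))"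
    using assms(3) by (simp add: integrable_measure_pmf_finite)
  finally show ?thesis .
qed

end

text \<open>Proposer and target have tags 1 and 0, and the tag of a node depends on its token set
  only, so their token sets differ.\<close>

lemma productive_sharedbit_proposals:
  assumes "finite V" "E \<subseteq> V \<times> V" "p \<in> set_pmf (sharedbit_proposals V E \<rho> r T)"
  shows "productive V T p"
  unfolding productive_def
proof (intro allI impI)
  fix u v assume uv: "p u = Some v"
  then have u: "u \<in> senders V E \<rho> r T" using sharedbit_proposals_support(1)[OF assms, of u] by fastforce
  then have v: "v \<in> zero_neighbors E \<rho> r T u" using sharedbit_proposals_support(2)[OF assms u] uv by auto
  have "tag \<rho> r T u \<noteq> tag \<rho> r T v" using u v unfolding senders_def zero_neighbors_def by simp
  then have "u \<noteq> v \<and> T u \<noteq> T v" unfolding tag_def by metis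
  then show "u \<in> V \<and> v \<in> V \<and> u \<noteq> v \<and> T u \<noteq> T v"
    using u v finite_zero_neighbors[OF assms(1,2)] unfolding senders_def by blast
qed

section \<open>Fresh bits in every round\<close>

text \<open>In each coordinate, drawing a value and then redrawing it has the same law as one draw;
  \<open>Pi_pmf_bind\<close> lifts this to the product.\<close>

lemma Pi_pmf_resample:
  assumes "finite I"
  shows "Pi_pmf I d p = do {
    f \<leftarrow> Pi_pmf I d p;
    g \<leftarrow> Pi_pmf I d p;
    return_pmf (\<lambda>x. if x \<in> I then if x \<in> A then g x else f x else d)}"
proof -
  have "Pi_pmf I d p = Pi_pmf I d (\<lambda>x. bind_pmf (p x) (\<lambda>y. if x \<in> A then p x else return_pmf y))"
  proof (intro Pi_pmf_cong refl)
    show "p x = bind_pmf (p x) (\<lambda>y. if x \<in> A then p x else return_pmf y)" for x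
      by (cases "x \<in> A") (simp_all add: bind_return_pmf')
  qed
  also have "\<dots> = do {f \<leftarrow> Pi_pmf I d p; Pi_pmf I d (\<lambda>x. if x \<in> A then p x else return_pmf (f x))}"
    using assms by (rule Pi_pmf_bind)
  also have "(\<lambda>f. Pi_pmf I d (\<lambda>x. if x \<in> A then p x else return_pmf (f x))) =
      (\<lambda>f. Pi_pmf I d (\<lambda>x. bind_pmf (p x) (\<lambda>y. return_pmf (if x \<in> A then y else f x))))"
  proof (intro ext Pi_pmf_cong refl)
    show "(if x \<in> A then p x else return_pmf (f x)) =
        bind_pmf (p x) (\<lambda>y. return_pmf (if x \<in> A then y else f x))" for f x
      by (cases "x \<in> A") (simp_all add: bind_return_pmf')
  qed
  also have "\<dots> = (\<lambda>f. do {g \<leftarrow> Pi_pmf I d p; Pi_pmf I d (\<lambda>x. return_pmf (if x \<in> A then g x else f x))})"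
    using assms by (intro ext Pi_pmf_bind)
  finally show ?thesis using assms by simp
qed

lemma sharedbit_proposals_cong:
  assumes "\<And>y. \<rho> (r, y) = \<rho>' (r, y)"
  shows "sharedbit_proposals V E \<rho> r T = sharedbit_proposals V E \<rho>' r T"
proof -
  have "tag \<rho> r T = tag \<rho>' r T" using assms unfolding tag_def by simp
  then show ?thesis unfolding sharedbit_proposals_def senders_def zero_neighbors_def by simp
qed

text \<open>Round \<open>r\<close> reads only group \<open>r\<close>. The bound on \<open>m\<close>
  excludes \<open>beyond\<close>, which may inspect the whole string.\<close>

lemma sharedbit_history_cong:
  assumes "\<And>r y. r \<le> m \<Longrightarrow> \<rho> (r, y) = \<rho>' (r, y)" "m \<le> c * N\<^sup>2"
  shows "sharedbit_history c N V G X beyond \<rho> m = sharedbit_history c N V G X beyond \<rho>' m"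
  using assms
proof (induction m)
  case (Suc m)
  then have "sharedbit_history c N V G X beyond \<rho> m = sharedbit_history c N V G X beyond \<rho>' m" by simp
  moreover have "sharedbit_proposals V (G (Suc m)) \<rho> (Suc m) T = sharedbit_proposals V (G (Suc m)) \<rho>' (Suc m) T"
    for T using Suc.prems(1) by (intro sharedbit_proposals_cong) simp
  ultimately show ?case using Suc.prems(2) by simp
qed simp

text \<open>The shared string is drawn independently of the current state, so that the state can be
  treated as fixed when tags are compared.\<close>

definition fresh_round ::
    "nat \<Rightarrow> nat \<Rightarrow> node set \<Rightarrow> (nat \<Rightarrow> graph) \<Rightarrow> subroutine \<Rightarrow> nat \<Rightarrow> state \<Rightarrow> state pmf" where
  "fresh_round c N V G X r T =
     bind_pmf (shared_string c N) (\<lambda>\<rho>. mtm_round V X (sharedbit_proposals V (G r) \<rho> r T) T)"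

text \<open>
  Group \<open>m + 1\<close> of the shared string does not influence the first \<open>m\<close> rounds, so it may be
  resampled before round \<open>m + 1\<close>.
\<close>

lemma sharedbit_Suc:
  assumes m: "Suc m \<le> c * N\<^sup>2"
  shows "sharedbit c N V G X beyond (Suc m) = do {
    h \<leftarrow> sharedbit c N V G X beyond m;
    T \<leftarrow> fresh_round c N V G X (Suc m) (last h);
    return_pmf (h @ [T])}"
proof -
  let ?S = "shared_string c N" and ?H = "\<lambda>\<rho>. sharedbit_history c N V G X beyond \<rho> m"
  let ?R = "\<lambda>\<rho> h. mtm_round V X (sharedbit_proposals V (G (Suc m)) \<rho> (Suc m) (last h)) (last h)"
  define K where "K \<rho> \<rho>' = bind_pmf (?H \<rho>) (\<lambda>h. bind_pmf (?R \<rho>' h) (\<lambda>T. return_pmf (h @ [T])))" for \<rho> \<rho>'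
  define I where "I = {1..c * N^2} \<times> {1..N} \<times> {..<nat \<lceil>log 2 (real N)\<rceil> + 1}"
  define A where "A = {x :: nat \<times> nat \<times> nat. fst x = Suc m}"
  let ?J = "\<lambda>f g x. if x \<in> I then if x \<in> A then g x else f x else False"
  have finI: "finite I" unfolding I_def by simp
  have S: "?S = Pi_pmf I False (\<lambda>_. pmf_of_set UNIV)" unfolding shared_string_def I_def ..
  \<comment> \<open>The mixed string is \<open>False\<close> off the index set, so it can agree with
    \<open>f\<close> and \<open>g\<close> there only because both take the default value.\<close>
  have outside: "f x = False" if "f \<in> set_pmf ?S" "x \<notin> I" for f x
    using that finI unfolding S by (cases x) (auto simp: set_Pi_pmf PiE_dflt_def)
  have J: "K (?J f g) (?J f g) = K f g" if fg: "f \<in> set_pmf ?S" "g \<in> set_pmf ?S" for f g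
  proof -
    have "?H (?J f g) = ?H f"
      using m outside[OF fg(1)] by (intro sharedbit_history_cong) (auto simp: A_def)
    moreover have "sharedbit_proposals V (G (Suc m)) (?J f g) (Suc m) T =
        sharedbit_proposals V (G (Suc m)) g (Suc m) T" for T
      using outside[OF fg(2)] by (intro sharedbit_proposals_cong) (auto simp: A_def)
    ultimately show ?thesis unfolding K_def by simp
  qed
  have "sharedbit c N V G X beyond (Suc m) = bind_pmf ?S (\<lambda>\<rho>. K \<rho> \<rho>)"
    using m unfolding sharedbit_def K_def by simp
  also have "\<dots> = bind_pmf ?S (\<lambda>f. bind_pmf ?S (\<lambda>g. K (?J f g) (?J f g)))"
    unfolding S by (subst Pi_pmf_resample[OF finI, of _ _ A]) (simp add: bind_assoc_pmf bind_return_pmf)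
  also have "\<dots> = bind_pmf ?S (\<lambda>f. bind_pmf ?S (\<lambda>g. K f g))"
    using J by (intro bind_pmf_cong refl)
  \<comment> \<open>The history depends on \<open>f\<close> alone, so \<open>g\<close> may be drawn
    after it.\<close>
  also have "\<dots> = bind_pmf ?S (\<lambda>f. bind_pmf (?H f)
      (\<lambda>h. bind_pmf ?S (\<lambda>g. bind_pmf (?R g h) (\<lambda>T. return_pmf (h @ [T])))))"
    unfolding K_def by (intro bind_pmf_cong refl bind_commute_pmf)
  finally show ?thesis unfolding sharedbit_def fresh_round_def by (simp add: bind_assoc_pmf)
qed

section \<open>Prefixes of a run\<close>

lemma length_sharedbit_history:
  "h \<in> set_pmf (sharedbit_history c N V G X beyond \<rho> m) \<Longrightarrow> length h = Suc m"
  by (induction m arbitrary: h) auto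

text \<open>Later rounds only append states. This reduces a horizon beyond
  \<open>c * N\<^sup>2\<close> to the rounds that have shared bits, whatever \<open>beyond\<close>
  does.\<close>

lemma take_sharedbit_history:
  "m \<le> k \<Longrightarrow> map_pmf (take (Suc m)) (sharedbit_history c N V G X beyond \<rho> k) =
    sharedbit_history c N V G X beyond \<rho> m"
proof (induction k)
  case 0
  then show ?case by simp
next
  case (Suc k)
  show ?case
  proof (cases "m = Suc k")
    case True
    show ?thesis
      unfolding True[symmetric] using length_sharedbit_history[of _ c N V G X beyond \<rho> m]
      by (intro map_pmf_idI) simp
  next
    case False
    then have mk: "m \<le> k" using Suc.prems by simp
    let ?H = "sharedbit_history c N V G X beyond \<rho> k"
    let ?N = "\<lambda>h. if Suc k \<le> c * N^2
      then mtm_round V X (sharedbit_proposals V (G (Suc k)) \<rho> (Suc k) (last h)) (last h) else beyond \<rho> h"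
    have "map_pmf (take (Suc m)) (sharedbit_history c N V G X beyond \<rho> (Suc k)) =
        bind_pmf ?H (\<lambda>h. bind_pmf (?N h) (\<lambda>T. return_pmf (take (Suc m) (h @ [T]))))"
      by (simp only: sharedbit_history.simps map_bind_pmf map_return_pmf)
    also have "\<dots> = bind_pmf ?H (\<lambda>h. bind_pmf (?N h) (\<lambda>T. return_pmf (take (Suc m) h)))"
      using mk length_sharedbit_history[of _ c N V G X beyond \<rho> k] by (intro bind_pmf_cong refl) simp
    also have "\<dots> = map_pmf (take (Suc m)) ?H" by (simp add: map_pmf_def)
    finally show ?thesis using Suc.IH[OF mk] by simp
  qed
qed

lemma take_sharedbit:
  "m \<le> k \<Longrightarrow> map_pmf (take (Suc m)) (sharedbit c N V G X beyond k) = sharedbit c N V G X beyond m"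
  unfolding sharedbit_def by (simp add: map_bind_pmf take_sharedbit_history)

section \<open>Unsolved rounds\<close>

context
  fixes q c N :: nat and V :: "node set" and \<delta> \<epsilon> :: real and X :: subroutine and G :: "nat \<Rightarrow> graph"
  assumes X: "is_transfer q V \<delta> X" and \<delta>: "\<delta> \<le> 1 / 2" and V: "V \<subseteq> {1..N}" "card V \<ge> 3"
    and G: "dynamic_graph V G" and \<epsilon>: "\<epsilon> < 1"
begin

lemma finite_nodes: "finite V" and nodes_nonempty: "V \<noteq> {}"
  using V finite_subset by auto

lemma edges_subset: "1 \<le> r \<Longrightarrow> G r \<subseteq> V \<times> V" and sym_edges: "1 \<le> r \<Longrightarrow> sym (G r)"
  using G unfolding dynamic_graph_def connected_graph_def by auto

definition mean_acceptors :: "nat \<Rightarrow> state \<Rightarrow> real" where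
  "mean_acceptors r T = measure_pmf.expectation (shared_string c N) (\<lambda>\<rho>.
     measure_pmf.expectation (sharedbit_proposals V (G r) \<rho> r T) (\<lambda>p. real (card (acceptors V p))))"

text \<open>For the first bound, a single edge between different token sets has differing tags with
  probability one half and then yields an acceptor. In the second, 128 is the product of 8 from the
  matching, 2 from the tags and 8 from the proposals.\<close>

lemma mean_acceptors_ge:
  assumes T: "gossip_state V T" "\<not> gossip_solved \<epsilon> V T" and r: "1 \<le> r" "r \<le> c * N\<^sup>2"
  shows "1 / 2 \<le> mean_acceptors r T"
    and "dyn_expansion V G * (1 - \<epsilon>) * real (card V) \<le>
      128 * sqrt (real (dyn_max_degree V G)) * mean_acceptors r T"
proof -
  let ?S = "shared_string c N" and ?\<alpha> = "dyn_expansion V G" and ?\<Delta> = "real (dyn_max_degree V G)"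
  let ?A = "\<lambda>\<rho>. measure_pmf.expectation (sharedbit_proposals V (G r) \<rho> r T) (\<lambda>p. real (card (acceptors V p)))"
  note finS = finite_set_shared_string[of c N]
  have card: "card V > 1" using V by simp
  have \<alpha>: "0 < ?\<alpha>" "?\<alpha> \<le> vertex_expansion V (G r)"
    using dyn_expansion_pos dyn_expansion_le G card r by auto
  have \<Delta>: "1 \<le> ?\<Delta>" using dyn_max_degree_ge_2[OF G V(2)] by simp
  obtain M where M: "M \<subseteq> G r" "inj_on fst M" "inj_on snd M" "\<forall>(u, v)\<in>M. T u \<noteq> T v"
    "?\<alpha> * (1 - \<epsilon>) * real (card V) \<le> 8 * real (card M)"
    using unsolved_matching[OF finite_nodes card edges_subset[OF r(1)], of ?\<alpha> T \<epsilon>] \<alpha> T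
    unfolding gossip_state_def by auto
  have finM: "finite M" using M(1) edges_subset[OF r(1)] finite_nodes by (meson finite_SigmaI finite_subset)
  let ?D = "\<lambda>\<rho>. {e \<in> M. tag \<rho> r T (fst e) \<noteq> tag \<rho> r T (snd e)}"
  have half: "measure_pmf.prob ?S {\<rho>. e \<in> ?D \<rho>} = 1 / 2" if e: "e \<in> M" for e
  proof -
    have "fst e \<in> V" "snd e \<in> V" "T (fst e) \<noteq> T (snd e)"
      using e M(1,4) edges_subset[OF r(1)] by auto
    then have Te: "T (fst e) \<subseteq> {1..N}" "T (snd e) \<subseteq> {1..N}" "T (fst e) \<noteq> T (snd e)"
      using T(1) V(1) unfolding gossip_state_def by blast+
    have De: "{\<rho>. e \<in> ?D \<rho>} = {\<rho>. tag \<rho> r T (fst e) \<noteq> tag \<rho> r T (snd e)}" using e by auto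
    show ?thesis unfolding De by (rule prob_tag_differ[OF Te r])
  qed
  have "0 < ?\<alpha> * (1 - \<epsilon>) * real (card V)" using \<alpha> \<epsilon> card by simp
  then have "M \<noteq> {}" using M(5) by auto
  then obtain e where e: "e \<in> M" by blast
  have "(1 :: real) / 2 = measure_pmf.expectation ?S (indicator {\<rho>. e \<in> ?D \<rho>})" using half[OF e] by simp
  also have "\<dots> \<le> mean_acceptors r T" unfolding mean_acceptors_def
  proof (intro expectation_mono_finite finS)
    fix \<rho>
    have "1 \<le> ?A \<rho>" if "e \<in> ?D \<rho>"
      using that M(1) sym_edges[OF r(1)] edges_subset[OF r(1)] finite_nodes
      by (intro differing_edge_acceptor[of V _ "fst e" "snd e"]) auto
    moreover have "0 \<le> ?A \<rho>" by (intro expectation_nonneg_pmf) simp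
    ultimately show "indicator {\<rho>. e \<in> ?D \<rho>} \<rho> \<le> ?A \<rho>" by (simp add: indicator_def)
  qed
  finally show "1 / 2 \<le> mean_acceptors r T" .
  have "real (card M) / 2 = (\<Sum>e\<in>M. 1 / 2)" by simp
  also have "\<dots> = (\<Sum>e\<in>M. measure_pmf.prob ?S {\<rho>. e \<in> ?D \<rho>})"
    by (intro sum.cong refl half[symmetric])
  also have "\<dots> = measure_pmf.expectation ?S (\<lambda>\<rho>. real (card (?D \<rho>)))"
    using finS finM by (intro expectation_card[symmetric]) auto
  also have "\<dots> \<le> measure_pmf.expectation ?S (\<lambda>\<rho>. 8 * sqrt ?\<Delta> * ?A \<rho>)"
    using finite_nodes edges_subset[OF r(1)] sym_edges[OF r(1)] \<Delta> M
      degree_le_dyn_max_degree[OF G r(1)]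
    by (intro expectation_mono_finite finS differing_le_expected_acceptors) auto
  also have "\<dots> = 8 * sqrt ?\<Delta> * mean_acceptors r T" unfolding mean_acceptors_def by simp
  finally show "?\<alpha> * (1 - \<epsilon>) * real (card V) \<le> 128 * sqrt ?\<Delta> * mean_acceptors r T"
    using M(5) by linarith
qed

lemma fresh_round_support:
  assumes "gossip_state V T" "1 \<le> r"
  shows "T' \<in> set_pmf (fresh_round c N V G X r T) \<Longrightarrow> gossip_state V T'"
    and "finite (set_pmf (fresh_round c N V G X r T))"
proof -
  note Q = productive_sharedbit_proposals[OF finite_nodes edges_subset[OF assms(2)]]
    finite_set_sharedbit_proposals[OF finite_nodes edges_subset[OF assms(2)]]
  note sup = mtm_round_support[OF finite_nodes X \<delta> nodes_nonempty assms(1) Q(1)]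
  show "gossip_state V T'" if "T' \<in> set_pmf (fresh_round c N V G X r T)"
    using that sup(1) unfolding fresh_round_def by auto
  show "finite (set_pmf (fresh_round c N V G X r T))"
    using sup(2)[OF _ Q(2)] finite_set_shared_string unfolding fresh_round_def by simp
qed

lemma expected_weight_fresh_round:
  assumes "gossip_state V T" "1 \<le> r"
  shows "measure_pmf.expectation (fresh_round c N V G X r T) (weight V) \<le>
    weight V T * (1 - mean_acceptors r T / (4 * real (card V)))"
proof -
  let ?S = "shared_string c N" and ?Q = "\<lambda>\<rho>. sharedbit_proposals V (G r) \<rho> r T"
  note finS = finite_set_shared_string[of c N]
  note Q = productive_sharedbit_proposals[OF finite_nodes edges_subset[OF assms(2)]]
    finite_set_sharedbit_proposals[OF finite_nodes edges_subset[OF assms(2)]]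
  have "measure_pmf.expectation (fresh_round c N V G X r T) (weight V) =
      measure_pmf.expectation ?S (\<lambda>\<rho>. measure_pmf.expectation (mtm_round V X (?Q \<rho>) T) (weight V))"
    unfolding fresh_round_def
    using Q mtm_round_support(2)[OF finite_nodes X \<delta> nodes_nonempty assms(1)]
    by (intro expectation_bind_finite finS) blast
  also have "\<dots> \<le> measure_pmf.expectation ?S (\<lambda>\<rho>. weight V T *
      (1 - measure_pmf.expectation (?Q \<rho>) (\<lambda>p. real (card (acceptors V p))) / (4 * real (card V))))"
    using Q expected_weight_mtm_round[OF finite_nodes X \<delta> nodes_nonempty assms(1)]
    by (intro expectation_mono_finite finS) blast
  also have "\<dots> = weight V T * (1 - mean_acceptors r T / (4 * real (card V)))"
    unfolding mean_acceptors_def using finS by (simp add: integrable_measure_pmf_finite)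
  finally show ?thesis .
qed

lemma sharedbit_support:
  assumes "m \<le> c * N\<^sup>2"
  shows "finite (set_pmf (sharedbit c N V G X beyond m)) \<and>
    (\<forall>h\<in>set_pmf (sharedbit c N V G X beyond m). h \<noteq> [] \<and> gossip_state V (last h))"
  using assms
proof (induction m)
  case 0
  then show ?case by (auto simp: sharedbit_def gossip_state_def finite_set_shared_string)
next
  case (Suc m)
  then show ?case
    using fresh_round_support[of _ "Suc m"] unfolding sharedbit_Suc[OF Suc.prems] by auto
qed

text \<open>The weight, counted only on histories without a solved state, starts at most at one and
  shrinks in expectation by \<open>exp (- \<beta>)\<close> per round. As it is at least
  \<open>exp (- card V)\<close> on such histories, Markov's inequality bounds their
  probability.\<close>

lemma prob_unsolved_le:
  assumes \<beta>: "\<And>r T. gossip_state V T \<Longrightarrow> \<not> gossip_solved \<epsilon> V T \<Longrightarrow> 1 \<le> r \<Longrightarrow> r \<le> c * N\<^sup>2 \<Longrightarrow>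
      4 * real (card V) * \<beta> \<le> mean_acceptors r T"
    and m: "m \<le> c * N\<^sup>2"
  shows "measure_pmf.prob (sharedbit c N V G X beyond m) {h. \<forall>T\<in>set h. \<not> gossip_solved \<epsilon> V T} \<le>
    exp (real (card V) - \<beta> * real m)"
proof -
  let ?H = "sharedbit c N V G X beyond" and ?n = "real (card V)"
  define bad where "bad h \<longleftrightarrow> (\<forall>T\<in>set h. \<not> gossip_solved \<epsilon> V T)" for h
  define w where "w h = of_bool (bad h) * weight V (last h)" for h
  have n: "?n > 0" using V by simp
  have "measure_pmf.expectation (?H m) w \<le> exp (- \<beta> * real m)"
    using m
  proof (induction m)
    case 0
    have "measure_pmf.expectation (?H 0) w \<le> measure_pmf.expectation (?H 0) (\<lambda>_. 1)"
      using sharedbit_support[OF 0]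
      by (intro expectation_mono_finite) (auto simp: w_def weight_def of_bool_def)
    then show ?case by simp
  next
    case (Suc m)
    note sup = sharedbit_support[OF Suc_leD[OF Suc.prems], of beyond]
    let ?R = "\<lambda>h. fresh_round c N V G X (Suc m) (last h)"
    have fin: "finite (set_pmf (?R h))" if "h \<in> set_pmf (?H m)" for h
      using that sup fresh_round_support(2) by simp
    have "measure_pmf.expectation (?H (Suc m)) w =
        measure_pmf.expectation (?H m) (\<lambda>h. measure_pmf.expectation (?R h) (\<lambda>T. w (h @ [T])))"
      unfolding sharedbit_Suc[OF Suc.prems] using sup fin
      by (simp add: expectation_bind_finite cong: expectation_cong)
    also have "\<dots> \<le> measure_pmf.expectation (?H m) (\<lambda>h. exp (- \<beta>) * w h)"
    proof (intro expectation_mono_finite)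
      fix h assume h: "h \<in> set_pmf (?H m)"
      then have T: "h \<noteq> []" "gossip_state V (last h)" using sup by auto
      \<comment> \<open>A bad extension has a bad prefix; ignoring whether the new state is solved
        only increases the expectation.\<close>
      have "measure_pmf.expectation (?R h) (\<lambda>T. w (h @ [T])) \<le>
          measure_pmf.expectation (?R h) (\<lambda>T. of_bool (bad h) * weight V T)"
        using fin[OF h] by (intro expectation_mono_finite) (auto simp: w_def bad_def weight_def)
      also have "\<dots> = of_bool (bad h) * measure_pmf.expectation (?R h) (weight V)" by simp
      also have "\<dots> \<le> exp (- \<beta>) * w h"
      proof (cases "bad h")
        case True
        then have "\<not> gossip_solved \<epsilon> V (last h)" using T(1) unfolding bad_def by simp
        then have "4 * ?n * \<beta> \<le> mean_acceptors (Suc m) (last h)" using \<beta> T(2) Suc.prems by simp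
        then have "\<beta> \<le> mean_acceptors (Suc m) (last h) / (4 * ?n)" using n by (simp add: field_simps)
        then have "1 - mean_acceptors (Suc m) (last h) / (4 * ?n) \<le> exp (- \<beta>)"
          using exp_ge_add_one_self[of "- \<beta>"] by linarith
        then have "weight V (last h) * (1 - mean_acceptors (Suc m) (last h) / (4 * ?n)) \<le>
            weight V (last h) * exp (- \<beta>)"
          by (intro mult_left_mono) (simp_all add: weight_def)
        then show ?thesis
          using True expected_weight_fresh_round[OF T(2), of "Suc m"] by (simp add: w_def mult.commute)
      qed (simp add: w_def)
      finally show "measure_pmf.expectation (?R h) (\<lambda>T. w (h @ [T])) \<le> exp (- \<beta>) * w h" .
    qed (use sup in simp)
    also have "\<dots> = exp (- \<beta>) * measure_pmf.expectation (?H m) w" by simp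
    also have "\<dots> \<le> exp (- \<beta>) * exp (- \<beta> * real m)" using Suc by (intro mult_left_mono) auto
    also have "\<dots> = exp (- \<beta> * real (Suc m))" by (simp add: algebra_simps flip: exp_add)
    finally show ?case .
  qed
  moreover have "exp (- ?n) * measure_pmf.prob (?H m) {h. bad h} \<le> measure_pmf.expectation (?H m) w"
  proof -
    have "exp (- ?n) * indicator {h. bad h} h \<le> w h" if "h \<in> set_pmf (?H m)" for h
    proof -
      have "gossip_state V (last h)" using sharedbit_support[OF m] that by blast
      then have "card (last h u) \<le> card V" if "u \<in> V" for u
        using that finite_nodes unfolding gossip_state_def by (intro card_mono) auto
      \<comment> \<open>At most \<open>card V\<close> tokens at each of \<open>card V\<close> nodes;
        after normalization the exponent is at most \<open>card V\<close>.\<close>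
      then have "token_count V (last h) \<le> card V * card V"
        unfolding token_count_def using sum_bounded_above[of V "\<lambda>u. card (last h u)" "card V"] by simp
      then have "real (token_count V (last h)) \<le> ?n * ?n" by (simp flip: of_nat_mult)
      then have "real (token_count V (last h)) / ?n \<le> ?n" using n by (simp add: divide_le_eq)
      then have "exp (- ?n) \<le> weight V (last h)" unfolding weight_def by simp
      then show ?thesis unfolding w_def by (simp add: indicator_def)
    qed
    then have "measure_pmf.expectation (?H m) (\<lambda>h. exp (- ?n) * indicator {h. bad h} h) \<le>
        measure_pmf.expectation (?H m) w"
      using sharedbit_support[OF m] by (intro expectation_mono_finite) auto
    then show ?thesis by simp
  qed
  ultimately have "exp (- ?n) * measure_pmf.prob (?H m) {h. bad h} \<le> exp (- \<beta> * real m)" by linarith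
  then have "exp ?n * (exp (- ?n) * measure_pmf.prob (?H m) {h. bad h}) \<le> exp ?n * exp (- \<beta> * real m)"
    by (intro mult_left_mono) auto
  then show ?thesis unfolding bad_def by (simp add: exp_minus exp_diff field_simps)
qed

text \<open>With \<open>\<beta> * m\<close> at least twice \<open>card V\<close>, the failure
  probability is at most \<open>exp (- card V)\<close>, hence below
  \<open>1 / card V\<close>.\<close>

lemma solves_gossip_if:
  assumes \<beta>: "\<And>r T. gossip_state V T \<Longrightarrow> \<not> gossip_solved \<epsilon> V T \<Longrightarrow> 1 \<le> r \<Longrightarrow> r \<le> c * N\<^sup>2 \<Longrightarrow>
      4 * real (card V) * \<beta> \<le> mean_acceptors r T"
    and m: "m \<le> c * N\<^sup>2" "m < f" "2 * real (card V) \<le> \<beta> * real m"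
  shows "solves_gossip \<epsilon> V (sharedbit c N V G X beyond) f"
proof -
  let ?H = "sharedbit c N V G X beyond" and ?n = "real (card V)"
  let ?good = "{h. \<exists>r\<in>{1..f}. gossip_solved \<epsilon> V (h ! (r - 1))}"
  let ?bad = "{h. \<forall>T\<in>set h. \<not> gossip_solved \<epsilon> V T}"
  have tk: "map_pmf (take (Suc m)) (?H f) = ?H m" using m(2) by (intro take_sharedbit) simp
  have "UNIV - ?good \<subseteq> take (Suc m) -` ?bad"
  proof
    fix h assume h: "h \<in> UNIV - ?good"
    have "\<not> gossip_solved \<epsilon> V (h ! i)" if "i < Suc m" for i
    proof -
      \<comment> \<open>Index \<open>i\<close> is the state at the beginning of round
        \<open>i + 1\<close>; the \<open>m + 1\<close> states of the prefix fall within the first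
        \<open>f\<close> rounds because \<open>m < f\<close>.\<close>
      have "Suc i \<in> {1..f}" using that m by simp
      then show ?thesis using h by force
    qed
    then show "h \<in> take (Suc m) -` ?bad" by (auto simp: in_set_conv_nth)
  qed
  then have "measure_pmf.prob (?H f) (UNIV - ?good) \<le> measure_pmf.prob (?H f) (take (Suc m) -` ?bad)"
    by (intro measure_pmf.finite_measure_mono) auto
  also have "\<dots> = measure_pmf.prob (?H m) ?bad"
    by (simp only: tk[symmetric] measure_map_pmf)
  also have "\<dots> \<le> exp (?n - \<beta> * real m)" by (rule prob_unsolved_le[OF \<beta> m(1)])
  also have "\<dots> \<le> exp (- ?n)" using m(3) by simp
  also have "\<dots> \<le> 1 / (1 + ?n)" by (intro exp_minus_le) simp
  also have "\<dots> \<le> 1 / ?n" using V by (intro divide_left_mono) auto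
  finally show ?thesis
    unfolding solves_gossip_def using measure_pmf.prob_compl[of ?good "?H f"] by simp
qed

end

section \<open>Choice of constants and the two ranges of the round bound\<close>

theorem theorem7p4:
  fixes q :: nat
  assumes "q \<ge> 1"
  shows "\<exists>(c\<^sub>0::nat)\<ge>1. \<exists>(d\<^sub>0::real)\<ge>1. \<exists>(C::real)>0. \<exists>n\<^sub>0::nat.
    \<forall>(c::nat) (d::real) (\<epsilon>::real) (\<tau>::enat) (N::nat) V G X beyond.
      c \<ge> c\<^sub>0 \<and> d \<ge> d\<^sub>0 \<and> 0 < \<epsilon> \<and> \<epsilon> < 1 \<and> \<tau> \<ge> 1 \<and>
      V \<subseteq> {1..N} \<and> card V > 1 \<and> card V \<ge> n\<^sub>0 \<and>
      dynamic_graph V G \<and> has_stability \<tau> G \<and>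
      is_transfer q V (real (card V) powr (- d)) X
      \<longrightarrow>
      solves_gossip \<epsilon> V (sharedbit c N V G X beyond)
        (nat \<lfloor>C * (real (card V) *
                 sqrt (real (dyn_max_degree V G) * log 2 (real (dyn_max_degree V G)))
                 / ((1 - \<epsilon>) * dyn_expansion V G))\<rfloor>)"
proof -
  \<comment> \<open>1024 is twice the 512 in the rate \<open>\<beta>\<close> below; the further 2
    absorbs the floor and the step from \<open>f\<close> to \<open>f - 1\<close>, since
    \<open>x \<ge> 1\<close>.\<close>
  have main: "solves_gossip \<epsilon> V (sharedbit c N V G X beyond)
      (nat \<lfloor>1026 * (real (card V) *
         sqrt (real (dyn_max_degree V G) * log 2 (real (dyn_max_degree V G)))
         / ((1 - \<epsilon>) * dyn_expansion V G))\<rfloor>)"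
    if H: "c \<ge> 16" "d \<ge> 1" "0 < \<epsilon>" "\<epsilon> < 1" "V \<subseteq> {1..N}" "card V \<ge> 3" "dynamic_graph V G"
      "is_transfer q V (real (card V) powr (- d)) X" for c N and d \<epsilon> :: real and V G X beyond
  proof -
    let ?n = "real (card V)" and ?\<Delta> = "real (dyn_max_degree V G)" and ?\<alpha> = "dyn_expansion V G"
    define x where "x = ?n * sqrt (?\<Delta> * log 2 ?\<Delta>) / ((1 - \<epsilon>) * ?\<alpha>)"
    define f where "f = nat \<lfloor>1026 * x\<rfloor>"
    have "?n powr (- d) \<le> ?n powr (- 1)" using H by (intro powr_mono) auto
    also have "\<dots> = 1 / ?n" using H by (simp add: powr_minus_divide)
    also have "\<dots> \<le> 1 / 2" using H by (intro divide_left_mono) auto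
    finally have \<delta>: "?n powr (- d) \<le> 1 / 2" .
    note ctx = H(8) \<delta> H(5,6,7,4)
    have n: "?n \<ge> 3" using H by simp
    have \<Delta>: "?\<Delta> \<ge> 2" using dyn_max_degree_ge_2[OF H(7,6)] by simp
    have finV: "finite V" and conn: "connected_graph V (G 1)" using H(7) unfolding dynamic_graph_def by auto
    have \<alpha>: "0 < ?\<alpha>" using dyn_expansion_pos[OF H(7)] H by simp
    have "?\<alpha> \<le> vertex_expansion V (G 1)" using H by (intro dyn_expansion_le) auto
    also have "\<dots> \<le> 2" using finV H by (intro vertex_expansion_le_2) auto
    finally have \<alpha>2: "?\<alpha> \<le> 2" .
    have "1 \<le> log 2 ?\<Delta>" using \<Delta> by (simp add: le_log_iff)
    then have "?\<Delta> * 1 \<le> ?\<Delta> * log 2 ?\<Delta>" using \<Delta> by (intro mult_left_mono) auto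
    then have root: "sqrt ?\<Delta> \<le> sqrt (?\<Delta> * log 2 ?\<Delta>)" by simp
    have s1: "1 \<le> sqrt ?\<Delta>" using \<Delta> by simp
    have den: "0 < (1 - \<epsilon>) * ?\<alpha>" using H \<alpha> by simp
    have xge: "?n * sqrt ?\<Delta> / ((1 - \<epsilon>) * ?\<alpha>) \<le> x"
      unfolding x_def using root den by (intro divide_right_mono mult_left_mono) auto
    have "(1 - \<epsilon>) * ?\<alpha> \<le> 1 * 2" using H \<alpha> \<alpha>2 by (intro mult_mono) auto
    moreover have "3 * 1 \<le> ?n * sqrt ?\<Delta>" using n s1 by (intro mult_mono) auto
    ultimately have "1 \<le> ?n * sqrt ?\<Delta> / ((1 - \<epsilon>) * ?\<alpha>)" using den by (simp add: le_divide_eq)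
    then have x1: "1 \<le> x" using xge by simp
    have f_ge: "1026 * x - 1 \<le> real f" unfolding f_def by linarith
    have "solves_gossip \<epsilon> V (sharedbit c N V G X beyond) f"
    proof (cases "f - 1 \<le> c * N\<^sup>2")
      case True
      \<comment> \<open>512 is the 128 of \<open>mean_acceptors_ge\<close> times the 4 in the weight
        decay.\<close>
      define \<beta> where "\<beta> = ?\<alpha> * (1 - \<epsilon>) / (512 * sqrt ?\<Delta>)"
      have \<beta>0: "0 \<le> \<beta>" unfolding \<beta>_def using \<alpha> H(4) by simp
      show ?thesis
      proof (rule solves_gossip_if[OF ctx _ True])
        show "f - 1 < f" using f_ge x1 by linarith
        show "4 * ?n * \<beta> \<le> mean_acceptors c N V G r T"
          if "gossip_state V T" "\<not> gossip_solved \<epsilon> V T" "1 \<le> r" "r \<le> c * N\<^sup>2" for r T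
          using mean_acceptors_ge(2)[OF ctx that] s1 unfolding \<beta>_def by (simp add: field_simps)
        have "2 * ?n = \<beta> * (1024 * (?n * sqrt ?\<Delta> / ((1 - \<epsilon>) * ?\<alpha>)))"
          unfolding \<beta>_def using den s1 H(4) \<alpha> by (simp add: field_simps)
        also have "\<dots> \<le> \<beta> * (1024 * x)"
          using xge \<beta>0 by (intro mult_left_mono) auto
        also have "\<dots> \<le> \<beta> * real (f - 1)"
          using f_ge x1 \<beta>0 by (intro mult_left_mono) auto
        finally show "2 * ?n \<le> \<beta> * real (f - 1)" .
      qed
    next
      case False
      show ?thesis
      \<comment> \<open>Here \<open>m = c * N\<^sup>2\<close>, all rounds with shared bits. The
        constant bound on acceptors gives the rate \<open>1 / (8 * n)\<close>, so
        \<open>16 * n\<^sup>2\<close> rounds are enough, which is why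
        \<open>c \<ge> 16\<close>.\<close>
      proof (rule solves_gossip_if[OF ctx])
        show "4 * ?n * (1 / (8 * ?n)) \<le> mean_acceptors c N V G r T"
          if "gossip_state V T" "\<not> gossip_solved \<epsilon> V T" "1 \<le> r" "r \<le> c * N\<^sup>2" for r T
          using mean_acceptors_ge(1)[OF ctx that] n by simp
        show "c * N\<^sup>2 < f" using False by simp
        have "card V \<le> N" using card_mono[OF _ H(5)] by simp
        then have "16 * (card V)\<^sup>2 \<le> c * N\<^sup>2" using H(1) by (intro mult_mono power_mono) auto
        then have "real (16 * (card V)\<^sup>2) \<le> real (c * N\<^sup>2)" by (simp only: of_nat_le_iff)
        then have "16 * ?n\<^sup>2 \<le> real (c * N\<^sup>2)" by simp
        then show "2 * ?n \<le> 1 / (8 * ?n) * real (c * N\<^sup>2)"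
          using n by (simp add: field_simps power2_eq_square)
      qed simp
    qed
    then show ?thesis unfolding f_def x_def .
  qed
  \<comment> \<open>The size threshold is 3: two nodes have degree 1, the logarithm vanishes and the
    bound would be zero rounds.\<close>
  show ?thesis
    by (rule exI[of _ 16], rule conjI, simp, rule exI[of _ 1], rule conjI, simp,
        rule exI[of _ 1026], rule conjI, simp, rule exI[of _ 3]) (use main in blast)
qed

end
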